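(* Let $G=([n],E(G))$ be a finite undirected graph and $k\in\mathbb{N}$. The algorithm described in the context outputs true if and only if $G$ is $k$-copwin, and it runs in time $O\big(kn^{k+1}(\bar d(G)+k)\big)$, where $\bar d(G)$ is the average degree of $G$.
   Context: Cops and Robbers: first each of $k$ cops chooses a starting vertex of $G$, then the robber chooses one; then the cops and the robber alternate turns, starting with the cops. On the cops' turn each cop moves to a vertex at distance at most $1$; on the robber's turn the robber moves to a vertex at distance at most $1$. Several cops may share a vertex. The cops win if at some point a cop is on the robber's vertex; otherwise the robber wins. $G$ is $k$-copwin if the $k$ cops have a winning strategy. Algorithm: If $k\ge n$, output true. Otherwise let $S=[n]^{k+1}\times\mathbb{Z}_{k+1}$, where $(p_0,\dots,p_k,t)$ means the robber is at $p_0$, cop $i$ at $p_i$, and piece $t$ moved last (piece $0$ = robber), the cops being thought of as moving one at a time in order $1,\dots,k$ followed by the robber. Let $H$ be the directed graph on $S$ with an arc $((p_0,\dots,p_k,t),(p_0',\dots,p_k',t'))$ iff $t'=(t+1)\bmod(k+1)$, ($\{p_{t'},p_{t'}'\}\in E(G)$ or $p_{t'}=p_{t'}'$), and $p_i=p_i'$ for all $i\ne t'$; let $I(s)$ be the set of in-neighbours of $s$ in $H$. Initialize a boolean array $\mathrm{COPSWIN}$ on $S$ to $0$, an integer array $\mathrm{COUNTER}$ on states $(p_0,\dots,p_k,k)$ initialized to $1+\deg_G(p_0)$, and an empty queue. Enqueue and mark ($\mathrm{COPSWIN}=1$) every state with $p_0=p_i$ for some $i\in[k]$. While the queue is nonempty,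 dequeue $s=(p_0,\dots,p_k,t)$: if $t\ne0$, enqueue and mark every unmarked $q\in I(s)$; if $t=0$, for each $q\in I(s)$ decrement $\mathrm{COUNTER}(q)$ and, if it becomes $0$ and $q$ is unmarked, enqueue and mark $q$. Finally output true iff there is $(p_1,\dots,p_k)\in[n]^k$ with $\mathrm{COPSWIN}((p_0,p_1,\dots,p_k,0))=1$ for all $p_0\in[n]$, and false otherwise. Time is measured in elementary operations (the graph is given by adjacency lists). *)

theory Defs
  imports Complex_Main "HOL-Library.Extended_Nat"
begin

section \<open>Graphs on $\{1,\dots,n\}$\<close>

definition simple_graph :: "nat \<Rightarrow> nat set set \<Rightarrow> bool" where
  "simple_graph n E \<longleftrightarrow> (\<forall>e\<in>E. e \<subseteq> {1..n} \<and> card e = 2)"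

definition degree :: "nat set set \<Rightarrow> nat \<Rightarrow> nat" where
  "degree E v = card {u. {v, u} \<in> E}"

definition average_degree :: "nat \<Rightarrow> nat set set \<Rightarrow> real" where
  "average_degree n E = (\<Sum>v = 1..n. real (degree E v)) / real n"

text \<open>The length of a shortest walk, which is \<open>\<infinity>\<close> if there is none.\<close>

definition gdist :: "nat set set \<Rightarrow> nat \<Rightarrow> nat \<Rightarrow> enat" where
  "gdist E u v = (INF d \<in> {d. (u, v) \<in> {(x, y). {x, y} \<in> E} ^^ d}. enat d)"


section \<open>The game\<close>

text \<open>
  A play of the robber is the sequence \<open>r 0, r 1, \<dots>\<close> of his positions: \<open>r 0\<close> is the starting
  vertex and \<open>r j\<close> the position after his \<open>j\<close>-th move.  It is taken to be infinite; what happens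
  after a capture is irrelevant.
\<close>

definition robber_play :: "nat \<Rightarrow> nat set set \<Rightarrow> (nat \<Rightarrow> nat) \<Rightarrow> bool" where
  "robber_play n E r \<longleftrightarrow> (\<forall>j. r j \<in> {1..n} \<and> gdist E (r j) (r (Suc j)) \<le> 1)"

text \<open>
  A strategy of the cops maps the robber's positions so far to the next positions of the cops;
  position \<open>i\<close> of the result, \<open>1 \<le> i \<le> k\<close>, belongs to cop \<open>i\<close>.  The empty history gives the
  starting vertices, so \<open>cops_at \<sigma> r 0\<close> is chosen before the robber has chosen \<open>r 0\<close>, and
  \<open>cops_at \<sigma> r (Suc j)\<close> is the reply to \<open>r 0, \<dots>, r j\<close>.  The cops' own earlier positions are
  determined by \<open>\<sigma>\<close> and the history.
\<close>

type_synonym strategy = "nat list \<Rightarrow> nat \<Rightarrow> nat"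

definition cops_at :: "strategy \<Rightarrow> (nat \<Rightarrow> nat) \<Rightarrow> nat \<Rightarrow> nat \<Rightarrow> nat" where
  "cops_at \<sigma> r j = \<sigma> (map r [0..<j])"

definition legal_strategy :: "nat \<Rightarrow> nat set set \<Rightarrow> nat \<Rightarrow> strategy \<Rightarrow> bool" where
  "legal_strategy n E k \<sigma> \<longleftrightarrow>
     (\<forall>r. robber_play n E r \<longrightarrow>
       (\<forall>j. \<forall>i\<in>{1..k}. cops_at \<sigma> r j i \<in> {1..n} \<and>
              gdist E (cops_at \<sigma> r j i) (cops_at \<sigma> r (Suc j) i) \<le> 1))"

text \<open>
  The robber at \<open>r j\<close> can be caught when he arrives there (the cops being at \<open>cops_at \<sigma> r j\<close>) or by
  the cops' next move.
\<close>

definition winning_strategy :: "nat \<Rightarrow> nat set set \<Rightarrow> nat \<Rightarrow> strategy \<Rightarrow> bool" where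
  "winning_strategy n E k \<sigma> \<longleftrightarrow>
     (\<forall>r. robber_play n E r \<longrightarrow>
       (\<exists>j. \<exists>i\<in>{1..k}. cops_at \<sigma> r j i = r j \<or> cops_at \<sigma> r (Suc j) i = r j))"

definition copwin :: "nat \<Rightarrow> nat set set \<Rightarrow> nat \<Rightarrow> bool" where
  "copwin n E k \<longleftrightarrow> (\<exists>\<sigma>. legal_strategy n E k \<sigma> \<and> winning_strategy n E k \<sigma>)"


section \<open>A random access machine language with unit costs\<close>

text \<open>
  Variables and array cells hold natural numbers.  Every constant, operator, variable access and
  array access in an expression that is evaluated costs one step, and so does every assignment
  and every test.
\<close>

type_synonym vname = string

record state =
  var :: "vname \<Rightarrow> nat"
  arr :: "vname \<Rightarrow> nat \<Rightarrow> nat"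

datatype aexp =
    N nat
  | V vname
  | Cell vname aexp  ("_\<lblot>_\<rblot>" [1000, 0] 1000)
  | Plus aexp aexp   (infixl "\<oplus>" 65)
  | Minus aexp aexp  (infixl "\<ominus>" 65)
  | Times aexp aexp  (infixl "\<otimes>" 70)
  | Div aexp aexp    (infixl "DIV" 70)
  | Mod aexp aexp    (infixl "MOD" 70)

datatype bexp =
    Less aexp aexp   (infix "\<prec>" 50)
  | Eq aexp aexp     (infix "\<doteq>" 50)
  | Not bexp
  | And bexp bexp    (infixr "AND" 35)

fun aval :: "aexp \<Rightarrow> state \<Rightarrow> nat" where
  "aval (N m) s = m"
| "aval (V x) s = var s x"
| "aval (Cell x a) s = arr s x (aval a s)"
| "aval (a \<oplus> b) s = aval a s + aval b s"
| "aval (a \<ominus> b) s = aval a s - aval b s"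
| "aval (a \<otimes> b) s = aval a s * aval b s"
| "aval (a DIV b) s = aval a s div aval b s"
| "aval (a MOD b) s = aval a s mod aval b s"

fun bval :: "bexp \<Rightarrow> state \<Rightarrow> bool" where
  "bval (a \<prec> b) s \<longleftrightarrow> aval a s < aval b s"
| "bval (a \<doteq> b) s \<longleftrightarrow> aval a s = aval b s"
| "bval (Not b) s \<longleftrightarrow> \<not> bval b s"
| "bval (b AND c) s \<longleftrightarrow> bval b s \<and> bval c s"

fun acost :: "aexp \<Rightarrow> nat" where
  "acost (N m) = 1"
| "acost (V x) = 1"
| "acost (Cell x a) = acost a + 1"
| "acost (a \<oplus> b) = acost a + acost b + 1"
| "acost (a \<ominus> b) = acost a + acost b + 1"
| "acost (a \<otimes> b) = acost a + acost b + 1"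
| "acost (a DIV b) = acost a + acost b + 1"
| "acost (a MOD b) = acost a + acost b + 1"

fun bcost :: "bexp \<Rightarrow> nat" where
  "bcost (a \<prec> b) = acost a + acost b + 1"
| "bcost (a \<doteq> b) = acost a + acost b + 1"
| "bcost (Not b) = bcost b + 1"
| "bcost (b AND c) = bcost b + bcost c + 1"

datatype com =
    SKIP
  | Assign vname aexp           ("_ ::= _" [1000, 61] 61)
  | Store vname aexp aexp       ("_\<lblot>_\<rblot> \<leftarrow> _" [1000, 0, 61] 61)
  | Seq com com                 (infixr ";;" 60)
  | If bexp com com             ("(IF _/ THEN _/ ELSE _)" [0, 0, 61] 61)
  | While bexp com              ("(WHILE _/ DO _)" [0, 61] 61)

inductive exec :: "com \<Rightarrow> state \<Rightarrow> nat \<Rightarrow> state \<Rightarrow> bool"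
  ("\<langle>_, _\<rangle> \<Rightarrow> _ \<Down> _" [0, 0, 51, 51] 50) where
  Skip: "\<langle>SKIP, s\<rangle> \<Rightarrow> 1 \<Down> s"
| Assign: "\<langle>x ::= a, s\<rangle> \<Rightarrow> acost a + 1 \<Down> s\<lparr>var := (var s)(x := aval a s)\<rparr>"
| Store: "\<langle>x\<lblot>a\<rblot> \<leftarrow> b, s\<rangle> \<Rightarrow> acost a + acost b + 1
            \<Down> s\<lparr>arr := (arr s)(x := (arr s x)(aval a s := aval b s))\<rparr>"
| Seq: "\<langle>c, s\<rangle> \<Rightarrow> t \<Down> s' \<Longrightarrow> \<langle>d, s'\<rangle> \<Rightarrow> t' \<Down> s'' \<Longrightarrow> \<langle>c ;; d, s\<rangle> \<Rightarrow> t + t' \<Down> s''"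
| IfTrue: "bval b s \<Longrightarrow> \<langle>c, s\<rangle> \<Rightarrow> t \<Down> s' \<Longrightarrow> \<langle>IF b THEN c ELSE d, s\<rangle> \<Rightarrow> bcost b + 1 + t \<Down> s'"
| IfFalse: "\<not> bval b s \<Longrightarrow> \<langle>d, s\<rangle> \<Rightarrow> t \<Down> s' \<Longrightarrow> \<langle>IF b THEN c ELSE d, s\<rangle> \<Rightarrow> bcost b + 1 + t \<Down> s'"
| WhileFalse: "\<not> bval b s \<Longrightarrow> \<langle>WHILE b DO c, s\<rangle> \<Rightarrow> bcost b + 1 \<Down> s"
| WhileTrue: "bval b s \<Longrightarrow> \<langle>c, s\<rangle> \<Rightarrow> t \<Down> s' \<Longrightarrow> \<langle>WHILE b DO c, s'\<rangle> \<Rightarrow> t' \<Down> s''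
                \<Longrightarrow> \<langle>WHILE b DO c, s\<rangle> \<Rightarrow> bcost b + 1 + t + t' \<Down> s''"

inductive_cases SkipE: "\<langle>SKIP, s\<rangle> \<Rightarrow> t \<Down> s'"
inductive_cases AssignE: "\<langle>x ::= a, s\<rangle> \<Rightarrow> t \<Down> s'"
inductive_cases StoreE: "\<langle>x\<lblot>a\<rblot> \<leftarrow> b, s\<rangle> \<Rightarrow> t \<Down> s'"
inductive_cases SeqE: "\<langle>c ;; d, s\<rangle> \<Rightarrow> t \<Down> s'"
inductive_cases IfE: "\<langle>IF b THEN c ELSE d, s\<rangle> \<Rightarrow> t \<Down> s'"
inductive_cases WhileE: "\<langle>WHILE b DO c, s\<rangle> \<Rightarrow> t \<Down> s'"

lemma exec_deterministic:
  "\<langle>c, s\<rangle> \<Rightarrow> t \<Down> s' \<Longrightarrow> \<langle>c, s\<rangle> \<Rightarrow> u \<Down> s'' \<Longrightarrow> u = t \<and> s'' = s'"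
proof (induction arbitrary: u s'' rule: exec.induct)
  case (Skip s)
  then show ?case by (rule SkipE) simp
next
  case (Assign x a s)
  then show ?case by (rule AssignE) simp
next
  case (Store x a b s)
  then show ?case by (rule StoreE) simp
next
  case (Seq c s t s1 d t1 s2)
  from Seq.prems show ?case
    by (rule SeqE) (drule Seq.IH(1), clarify, drule Seq.IH(2), simp)
next
  case (IfTrue b s c t s1 d)
  from IfTrue.prems obtain v where "u = bcost b + 1 + v" "\<langle>c, s\<rangle> \<Rightarrow> v \<Down> s''"
    by (rule IfE) (use IfTrue.hyps in auto)
  then show ?case using IfTrue.IH by blast
next
  case (IfFalse b s d t s1 c)
  from IfFalse.prems obtain v where "u = bcost b + 1 + v" "\<langle>d, s\<rangle> \<Rightarrow> v \<Down> s''"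
    by (rule IfE) (use IfFalse.hyps in auto)
  then show ?case using IfFalse.IH by blast
next
  case (WhileFalse b s c)
  from WhileFalse.prems show ?case by (rule WhileE) (use WhileFalse.hyps in auto)
next
  case (WhileTrue b s c t s1 t1 s2)
  from WhileTrue.prems obtain v v' r where
    "u = bcost b + 1 + v + v'" "\<langle>c, s\<rangle> \<Rightarrow> v \<Down> r" "\<langle>WHILE b DO c, r\<rangle> \<Rightarrow> v' \<Down> s''"
    by (rule WhileE) (use WhileTrue.hyps in auto)
  then show ?case using WhileTrue.IH by blast
qed

text \<open>The loop over \<open>lo, \<dots>, hi - 1\<close>:\<close>

definition For :: "vname \<Rightarrow> aexp \<Rightarrow> aexp \<Rightarrow> com \<Rightarrow> com"
  ("(FOR _ FROM _ BELOW _/ DO _)" [1000, 0, 0, 61] 61) where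
  "FOR x FROM lo BELOW hi DO c = x ::= lo ;; WHILE V x \<prec> hi DO (c ;; x ::= V x \<oplus> N 1)"

definition When :: "bexp \<Rightarrow> com \<Rightarrow> com"  ("(WHEN _/ DO _)" [0, 61] 61) where
  "WHEN b DO c = IF b THEN c ELSE SKIP"


section \<open>The algorithm\<close>

text \<open>
  The input: the adjacency lists, in any order, are stored one after the other in the array
  \<open>adj\<close>; that of vertex \<open>v\<close> occupies the cells from \<open>start v\<close> up to, but excluding,
  \<open>start (v + 1)\<close>.  Nothing is assumed about the other variables and arrays.
\<close>

definition adjacency_lists :: "nat \<Rightarrow> nat set set \<Rightarrow> (nat \<Rightarrow> nat list) \<Rightarrow> bool" where
  "adjacency_lists n E A \<longleftrightarrow> (\<forall>v\<in>{1..n}. distinct (A v) \<and> set (A v) = {u. {v, u} \<in> E})"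

definition input_state :: "nat \<Rightarrow> nat \<Rightarrow> (nat \<Rightarrow> nat list) \<Rightarrow> state \<Rightarrow> bool" where
  "input_state n k A s \<longleftrightarrow>
     var s ''n'' = n \<and> var s ''k'' = k \<and>
     (\<forall>v\<in>{1..n + 1}. arr s ''start'' v = (\<Sum>u = 1..<v. length (A u))) \<and>
     (\<forall>v\<in>{1..n}. \<forall>j<length (A v). arr s ''adj'' (arr s ''start'' v + j) = A v ! j)"

text \<open>
  With \<open>size = n ^ (k + 1)\<close>, the state $(p_0,\dots,p_k,t)$ is the number
  $t \cdot \mathit{size} + \sum_{i=0}^{k} (p_i - 1)\, n^i$, which is below \<open>(k + 1) * size\<close>;
  \<open>pow\<close> holds the powers of \<open>n\<close>.  The arrays \<open>copswin\<close> and \<open>counter\<close> are indexed by states, the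
  latter being used only for \<open>t = k\<close>.  The queue consists of the cells from \<open>head\<close> up to, but
  excluding, \<open>tail\<close> of the array \<open>queue\<close>.
\<close>

definition enqueue_and_mark :: "vname \<Rightarrow> com" where
  "enqueue_and_mark x =
     (''copswin''\<lblot>V x\<rblot> \<leftarrow> N 1 ;;
      ''queue''\<lblot>V ''tail''\<rblot> \<leftarrow> V x ;;
      ''tail'' ::= V ''tail'' \<oplus> N 1)"

definition compute_powers :: com where
  "compute_powers =
     (''pow''\<lblot>N 0\<rblot> \<leftarrow> N 1 ;;
      (FOR ''i'' FROM N 0 BELOW V ''k'' \<oplus> N 1 DO
         ''pow''\<lblot>V ''i'' \<oplus> N 1\<rblot> \<leftarrow> ''pow''\<lblot>V ''i''\<rblot> \<otimes> V ''n'') ;;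
      ''size'' ::= ''pow''\<lblot>V ''k'' \<oplus> N 1\<rblot>)"

definition initialize_arrays :: com where
  "initialize_arrays =
     ((FOR ''s'' FROM N 0 BELOW (V ''k'' \<oplus> N 1) \<otimes> V ''size'' DO
         ''copswin''\<lblot>V ''s''\<rblot> \<leftarrow> N 0) ;;
      (FOR ''s'' FROM V ''k'' \<otimes> V ''size'' BELOW (V ''k'' \<oplus> N 1) \<otimes> V ''size'' DO
         (''p'' ::= V ''s'' MOD V ''n'' \<oplus> N 1 ;;
          ''counter''\<lblot>V ''s''\<rblot> \<leftarrow> N 1 \<oplus> (''start''\<lblot>V ''p'' \<oplus> N 1\<rblot> \<ominus> ''start''\<lblot>V ''p''\<rblot>))) ;;
      ''head'' ::= N 0 ;;
      ''tail'' ::= N 0)"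

definition enqueue_captures :: com where
  "enqueue_captures =
     (FOR ''s'' FROM N 0 BELOW (V ''k'' \<oplus> N 1) \<otimes> V ''size'' DO
        FOR ''i'' FROM N 1 BELOW V ''k'' \<oplus> N 1 DO
          WHEN (V ''s'' DIV ''pow''\<lblot>V ''i''\<rblot>) MOD V ''n'' \<doteq> V ''s'' MOD V ''n''
               AND ''copswin''\<lblot>V ''s''\<rblot> \<doteq> N 0 DO
            enqueue_and_mark ''s'')"

text \<open>
  The in-neighbours of $s = (p_0,\dots,p_k,t)$ have $(t - 1) \bmod (k + 1)$ as last component, and
  in place of $p_t$ they have $p_t$ itself or a neighbour \<open>v\<close> of it.  The number \<open>base\<close> stands for
  such a state with the contribution of coordinate \<open>t\<close> left out.
\<close>

definition process_queue :: com where
  "process_queue =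
     (WHILE V ''head'' \<prec> V ''tail'' DO
        (''s'' ::= ''queue''\<lblot>V ''head''\<rblot> ;;
         ''head'' ::= V ''head'' \<oplus> N 1 ;;
         ''t'' ::= V ''s'' DIV V ''size'' ;;
         ''p'' ::= (V ''s'' DIV ''pow''\<lblot>V ''t''\<rblot>) MOD V ''n'' \<oplus> N 1 ;;
         ''base'' ::= ((V ''t'' \<oplus> V ''k'') MOD (V ''k'' \<oplus> N 1)) \<otimes> V ''size'' \<oplus>
                      (V ''s'' MOD V ''size'' \<ominus> (V ''p'' \<ominus> N 1) \<otimes> ''pow''\<lblot>V ''t''\<rblot>) ;;
         (FOR ''j'' FROM N 0 BELOW
              N 1 \<oplus> (''start''\<lblot>V ''p'' \<oplus> N 1\<rblot> \<ominus> ''start''\<lblot>V ''p''\<rblot>) DO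
            ((IF V ''j'' \<doteq> N 0
              THEN ''v'' ::= V ''p''
              ELSE ''v'' ::= ''adj''\<lblot>''start''\<lblot>V ''p''\<rblot> \<oplus> V ''j'' \<ominus> N 1\<rblot>) ;;
             ''q'' ::= V ''base'' \<oplus> (V ''v'' \<ominus> N 1) \<otimes> ''pow''\<lblot>V ''t''\<rblot> ;;
             (IF V ''t'' \<doteq> N 0
              THEN
                (''counter''\<lblot>V ''q''\<rblot> \<leftarrow> ''counter''\<lblot>V ''q''\<rblot> \<ominus> N 1 ;;
                 (WHEN ''counter''\<lblot>V ''q''\<rblot> \<doteq> N 0 AND ''copswin''\<lblot>V ''q''\<rblot> \<doteq> N 0 DO
                    enqueue_and_mark ''q''))
              ELSE
                (WHEN ''copswin''\<lblot>V ''q''\<rblot> \<doteq> N 0 DO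
                   enqueue_and_mark ''q''))))))"

text \<open>
  A placement $(p_1,\dots,p_k)$ of the cops is the number $c = \sum_{i=1}^{k} (p_i - 1)\, n^{i-1}$,
  so that the state $(p_0,p_1,\dots,p_k,0)$ is the number $(p_0 - 1) + n c$.
\<close>

definition compute_output :: com where
  "compute_output =
     (''result'' ::= N 0 ;;
      (FOR ''c'' FROM N 0 BELOW ''pow''\<lblot>V ''k''\<rblot> DO
         (''all'' ::= N 1 ;;
          (FOR ''p'' FROM N 1 BELOW V ''n'' \<oplus> N 1 DO
             WHEN ''copswin''\<lblot>(V ''p'' \<ominus> N 1) \<oplus> V ''n'' \<otimes> V ''c''\<rblot> \<doteq> N 0 DO
               ''all'' ::= N 0) ;;
          (WHEN V ''all'' \<doteq> N 1 DO ''result'' ::= N 1))))"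

definition copwin_algorithm :: com where
  "copwin_algorithm =
     (IF Not (V ''k'' \<prec> V ''n'')
      THEN ''result'' ::= N 1
      ELSE
        (compute_powers ;;
         initialize_arrays ;;
         enqueue_captures ;;
         process_queue ;;
         compute_output))"

end

theory Submission
  imports Defs
begin

text \<open>The cops move together in the game and one at a time in the algorithm. Both agree
  because a cop who lands on the robber in the middle of a turn does not move again in it, so the
  capture still stands when the turn is complete. The bound on the number of rounds is uniform in
  the robber's answers because he has at most \<open>n\<close> options; it is the quantity that
  drops along a play.

  The counters are tied to dequeued codes and not to marked ones, since a code may be marked long
  before its dequeuing decrements anything. While in-neighbours are scanned some counters are ahead
  of others, which is why each is compared with a set of its own.

  Running time is part of the loop invariants: a clock runs along with the state. In the main loop
  it is charged to the set of dequeued codes, so that the summation over degrees takes place only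
  once, after the loop. All constants are rounded up generously.\<close>

text \<open>
  The positions that the cops win form the least set that contains the captures and is closed under
  one step of the game seen backwards.  The marked codes are exactly this set: a code is marked only
  if it lies in it, and once the queue is empty the marked codes satisfy the closure conditions,
  since the counter of a position with the robber to move is the number of its successors that have
  not been dequeued.  As each code is enqueued at most once, scanning in-neighbours costs a
  sum of degrees over all codes, which is $(k + 1)\, n^k$ times the sum over all vertices.

  The game on single piece moves agrees with \<open>copwin\<close>: outside the set the robber has an escape that
  answers every legal strategy, and inside it a bound on the number of rounds gives a positional
  strategy.
\<close>

section \<open>Weakest preconditions with a clock\<close>

text \<open>The clock is a second argument, so that an invariant can bound the time elapsed since
  the start of the program and no recurrence for running times has to be solved. Demanding a run
  makes this total correctness.\<close>

definition wp :: "com \<Rightarrow> (state \<Rightarrow> nat \<Rightarrow> bool) \<Rightarrow> state \<Rightarrow> nat \<Rightarrow> bool" where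
  "wp c Q s \<tau> \<longleftrightarrow> (\<exists>u s'. \<langle>c, s\<rangle> \<Rightarrow> u \<Down> s' \<and> Q s' (\<tau> + u))"

lemma wp_mono:
  "wp c Q s \<tau> \<Longrightarrow> (\<And>s \<tau>. Q s \<tau> \<Longrightarrow> Q' s \<tau>) \<Longrightarrow> wp c Q' s \<tau>"
  unfolding wp_def by blast

lemma wp_Skip [simp]: "wp SKIP Q s \<tau> \<longleftrightarrow> Q s (\<tau> + 1)"
  unfolding wp_def by (metis SkipE exec.Skip)

lemma wp_Assign [simp]:
  "wp (x ::= a) Q s \<tau> \<longleftrightarrow> Q (s\<lparr>var := (var s)(x := aval a s)\<rparr>) (\<tau> + (acost a + 1))"
  unfolding wp_def by (metis AssignE exec.Assign)

lemma wp_Store [simp]: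
  "wp (x\<lblot>a\<rblot> \<leftarrow> b) Q s \<tau> \<longleftrightarrow>
     Q (s\<lparr>arr := (arr s)(x := (arr s x)(aval a s := aval b s))\<rparr>) (\<tau> + (acost a + acost b + 1))"
  unfolding wp_def by (metis StoreE exec.Store)

lemma wp_Seq [simp]: "wp (c ;; d) Q s \<tau> \<longleftrightarrow> wp c (wp d Q) s \<tau>"
proof
  assume "wp (c ;; d) Q s \<tau>"
  then show "wp c (wp d Q) s \<tau>"
    unfolding wp_def by (auto elim!: SeqE simp: add.assoc)
next
  assume "wp c (wp d Q) s \<tau>"
  then show "wp (c ;; d) Q s \<tau>"
    unfolding wp_def by (metis exec.Seq add.assoc)
qed

lemma wp_If [simp]:
  "wp (IF b THEN c ELSE d) Q s \<tau> \<longleftrightarrow>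
     (if bval b s then wp c Q s (\<tau> + (bcost b + 1)) else wp d Q s (\<tau> + (bcost b + 1)))"
proof
  assume "wp (IF b THEN c ELSE d) Q s \<tau>"
  then show "if bval b s then wp c Q s (\<tau> + (bcost b + 1)) else wp d Q s (\<tau> + (bcost b + 1))"
    unfolding wp_def by (auto elim!: IfE simp: add.assoc) (metis add_Suc_right)+
next
  assume "if bval b s then wp c Q s (\<tau> + (bcost b + 1)) else wp d Q s (\<tau> + (bcost b + 1))"
  then show "wp (IF b THEN c ELSE d) Q s \<tau>"
    unfolding wp_def by (metis IfTrue IfFalse add.assoc)
qed

lemma wp_While:
  fixes m :: "state \<Rightarrow> nat"
  assumes "I s \<tau>"
    and step: "\<And>s \<tau>. I s \<tau> \<Longrightarrow> bval b s \<Longrightarrow>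
      wp c (\<lambda>s' \<tau>'. I s' \<tau>' \<and> m s' < m s) s (\<tau> + (bcost b + 1))"
    and final: "\<And>s \<tau>. I s \<tau> \<Longrightarrow> \<not> bval b s \<Longrightarrow> Q s (\<tau> + (bcost b + 1))"
  shows "wp (WHILE b DO c) Q s \<tau>"
  using assms(1)
proof (induction "m s" arbitrary: s \<tau> rule: less_induct)
  case less
  show ?case
  proof (cases "bval b s")
    case True
    from step[OF less.prems True] obtain u s1 where
      u: "\<langle>c, s\<rangle> \<Rightarrow> u \<Down> s1" "I s1 (\<tau> + (bcost b + 1) + u)" "m s1 < m s"
      unfolding wp_def by blast
    from less.hyps[OF u(3,2)] obtain u' s2 where
      "\<langle>WHILE b DO c, s1\<rangle> \<Rightarrow> u' \<Down> s2" "Q s2 (\<tau> + (bcost b + 1) + u + u')"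
      unfolding wp_def by blast
    with exec.WhileTrue[OF True u(1)] show ?thesis
      unfolding wp_def by (metis add.assoc)
  next
    case False
    with final[OF less.prems] exec.WhileFalse show ?thesis
      unfolding wp_def by blast
  qed
qed

text \<open>The bound \<open>hi\<close> is evaluated anew before every iteration, so the invariant
  has to fix its value \<open>h\<close>. The clock offsets are the costs of the loop itself:
  \<open>acost hi + 3\<close> for a test and 4 for the increment of \<open>x\<close>.\<close>

lemma wp_For:
  assumes init: "I (aval lo s) (s\<lparr>var := (var s)(x := aval lo s)\<rparr>) (\<tau> + (acost lo + 1))"
    and le: "aval lo s \<le> h"
    and bound: "\<And>j r \<rho>. I j r \<rho> \<Longrightarrow> var r x = j \<Longrightarrow> aval hi r = h"
    and step: "\<And>j r \<rho>. aval lo s \<le> j \<Longrightarrow> j < h \<Longrightarrow> I j r \<rho> \<Longrightarrow> var r x = j \<Longrightarrow>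
      wp c (\<lambda>r' \<rho>'. var r' x = j \<and> I (Suc j) (r'\<lparr>var := (var r')(x := Suc j)\<rparr>) (\<rho>' + 4))
        r (\<rho> + (acost hi + 3))"
    and final: "\<And>r \<rho>. I h r \<rho> \<Longrightarrow> var r x = h \<Longrightarrow> Q r (\<rho> + (acost hi + 3))"
  shows "wp (FOR x FROM lo BELOW hi DO c) Q s \<tau>"
  unfolding For_def wp_Seq wp_Assign
proof (rule wp_While[where I = "\<lambda>r \<rho>. aval lo s \<le> var r x \<and> var r x \<le> h \<and> I (var r x) r \<rho>"
      and m = "\<lambda>r. h - var r x"])
  fix r \<rho>
  assume I: "aval lo s \<le> var r x \<and> var r x \<le> h \<and> I (var r x) r \<rho>" and "bval (V x \<prec> hi) r"
  then have less: "var r x < h"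
    using bound by fastforce
  with I step[of "var r x" r \<rho>]
  have "wp c (\<lambda>r' \<rho>'. var r' x = var r x \<and>
      I (Suc (var r x)) (r'\<lparr>var := (var r')(x := Suc (var r x))\<rparr>) (\<rho>' + 4)) r (\<rho> + (acost hi + 3))"
    by blast
  then have "wp c (wp (x ::= V x \<oplus> N 1) (\<lambda>r' \<rho>'. (aval lo s \<le> var r' x \<and> var r' x \<le> h \<and>
      I (var r' x) r' \<rho>') \<and> h - var r' x < h - var r x)) r (\<rho> + (acost hi + 3))"
    by (rule wp_mono) (use less I in \<open>auto simp: numeral_eq_Suc\<close>)
  then show "wp (c ;; x ::= V x \<oplus> N 1) (\<lambda>r' \<rho>'. (aval lo s \<le> var r' x \<and> var r' x \<le> h \<and>
      I (var r' x) r' \<rho>') \<and> h - var r' x < h - var r x) r (\<rho> + (bcost (V x \<prec> hi) + 1))"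
    by (simp add: numeral_3_eq_3)
next
  fix r \<rho>
  assume I: "aval lo s \<le> var r x \<and> var r x \<le> h \<and> I (var r x) r \<rho>" and "\<not> bval (V x \<prec> hi) r"
  then have "var r x = h"
    using bound by fastforce
  then show "Q r (\<rho> + (bcost (V x \<prec> hi) + 1))"
    using final[of r \<rho>] I by (simp add: numeral_3_eq_3)
qed (use init le in simp_all)

lemma wp_When [simp]:
  "wp (WHEN b DO c) Q s \<tau> \<longleftrightarrow>
     (if bval b s then wp c Q s (\<tau> + (bcost b + 1)) else Q s (\<tau> + (bcost b + 2)))"
  unfolding When_def by simp

section \<open>Digits\<close>

lemma digit_mod_power:
  fixes n x :: nat
  assumes "j < t" "n > 0"
  shows "(x mod n ^ t) div n ^ j mod n = x div n ^ j mod n"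
proof -
  define c where "c = n ^ (t - j)"
  have "n ^ t = n ^ j * c"
    using assms by (simp add: c_def flip: power_add)
  then have "(x mod n ^ t) div n ^ j = x div n ^ j mod c"
    using assms by (simp add: mod_mult2_eq)
  moreover have "n dvd c"
    using assms by (simp add: c_def dvd_power)
  ultimately show ?thesis
    by (simp add: mod_mod_cancel)
qed

lemma div_power_div:
  fixes n x :: nat
  assumes "i \<le> j"
  shows "x div n ^ j = x div n ^ i div n ^ (j - i)"
  using assms by (simp flip: div_mult2_eq power_add)

lemma mod_power_eqI:
  fixes n x y :: nat
  assumes "\<And>i. i < m \<Longrightarrow> x div n ^ i mod n = y div n ^ i mod n"
  shows "x mod n ^ m = y mod n ^ m"
  using assms
proof (induction m)
  case (Suc m)
  then show ?case
    by (simp add: mod_mult2_eq mult.commute[of n])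
qed simp

text \<open>Splitting \<open>x\<close> into the digits above \<open>t\<close>, digit
  \<open>t\<close> and the rest \<open>b\<close> shows that the subtraction of natural numbers is
  exact and that inserting \<open>e < n\<close> causes no carry.\<close>

lemma replace_digit:
  fixes n x t e :: nat
  assumes "e < n"
  defines "y \<equiv> x - (x div n ^ t mod n) * n ^ t + e * n ^ t"
  shows "j < t \<Longrightarrow> y div n ^ j mod n = x div n ^ j mod n"
    and "y div n ^ t mod n = e"
    and "y div n ^ Suc t = x div n ^ Suc t"
    and "t < j \<Longrightarrow> y div n ^ j mod n = x div n ^ j mod n"
proof -
  define a where "a = x div n ^ Suc t"
  define b where "b = x mod n ^ t"
  have n: "n > 0"
    using assms by simp
  have b: "b < n ^ t"
    using n by (simp add: b_def)
  have "x = x div n ^ t * n ^ t + b"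
    by (simp add: b_def div_mult_mod_eq)
  also have "x div n ^ t = a * n + x div n ^ t mod n"
    unfolding a_def by (metis div_mult2_eq div_mult_mod_eq power_Suc2)
  finally have "x = (x div n ^ t mod n) * n ^ t + (a * n * n ^ t + b)"
    by (simp add: algebra_simps)
  then have "x - (x div n ^ t mod n) * n ^ t = a * n * n ^ t + b"
    by (metis add_diff_cancel_left')
  then have y: "y = (a * n + e) * n ^ t + b"
    by (simp add: y_def algebra_simps)
  have yt: "y div n ^ t = a * n + e"
    unfolding y using b n by simp
  then show "y div n ^ t mod n = e"
    using assms by simp
  have "y div n ^ Suc t = y div n ^ t div n"
    by (metis div_mult2_eq power_Suc2)
  then show yS: "y div n ^ Suc t = x div n ^ Suc t"
    unfolding yt using assms by (simp add: a_def)
  have "y mod n ^ t = x mod n ^ t"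
    unfolding y using b by (simp add: b_def)
  then show "j < t \<Longrightarrow> y div n ^ j mod n = x div n ^ j mod n"
    using n by (metis digit_mod_power)
  show "t < j \<Longrightarrow> y div n ^ j mod n = x div n ^ j mod n"
    using div_power_div[of "Suc t" j] yS by (metis Suc_leI)
qed

text \<open>A digit value \<open>d\<close> at place \<open>t\<close> is shared by
  \<open>n ^ k\<close> numbers, namely all \<open>a * n ^ Suc t + d * n ^ t + b\<close> with
  \<open>a < n ^ (k - t)\<close> and \<open>b < n ^ t\<close>. This later turns a sum over codes
  into a sum over vertices.\<close>

lemma sum_digit:
  fixes f :: "nat \<Rightarrow> nat"
  assumes "t \<le> k" "n > 0"
  shows "(\<Sum>m<n ^ (k + 1). f (m div n ^ t mod n)) = n ^ k * (\<Sum>d<n. f d)"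
proof -
  have e: "n ^ (k + 1) = n ^ (k - t) * n ^ Suc t" "n ^ k = n ^ (k - t) * n ^ t"
    using assms by (simp_all flip: power_add power_Suc)
  have d: "(a * n ^ Suc t + (d * n ^ t + b)) div n ^ t mod n = d"
    if "d < n" "b < n ^ t" for a d b
  proof -
    have "a * n ^ Suc t + (d * n ^ t + b) = (a * n + d) * n ^ t + b"
      by (simp add: algebra_simps)
    then show ?thesis
      using that by (simp only:) simp
  qed
  have grp: "(\<Sum>x<p * q. g x) = (\<Sum>i<p. \<Sum>j<q. g (i * q + j))" for p q and g :: "nat \<Rightarrow> nat"
  proof -
    have "(\<Sum>j<q. g (i * q + j)) = sum g {i * q..<i * q + q}" for i
      using sum.shift_bounds_nat_ivl[of g 0 "i * q" q] by (simp add: lessThan_atLeast0 add.commute)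
    then have "(\<Sum>i<p. \<Sum>j<q. g (i * q + j)) = (\<Sum>i<p. sum g {i * q..<i * q + q})"
      by simp
    also have "\<dots> = sum g {..<p * q}"
      by (rule sum.nat_group)
    finally show ?thesis ..
  qed
  have "(\<Sum>m<n ^ (k + 1). f (m div n ^ t mod n)) =
      (\<Sum>a<n ^ (k - t). \<Sum>d<n. \<Sum>b<n ^ t. f ((a * n ^ Suc t + (d * n ^ t + b)) div n ^ t mod n))"
    by (simp only: e(1) grp power_Suc)
  also have "\<dots> = (\<Sum>a<n ^ (k - t). \<Sum>d<n. \<Sum>b<n ^ t. f d)"
    by (intro sum.cong refl) (subst d, auto)
  also have "\<dots> = n ^ k * (\<Sum>d<n. f d)"
    by (simp add: e sum_distrib_left mult.assoc)
  finally show ?thesis .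
qed

section \<open>The game\<close>

text \<open>The distance is an infimum, so a small value has to be traced back to a walk: if all
  walks had length at least 2, then 2 would be a lower bound.\<close>

lemma gdist_le_1_iff: "gdist E u v \<le> 1 \<longleftrightarrow> u = v \<or> {u, v} \<in> E"
proof
  let ?D = "{d. (u, v) \<in> {(x, y). {x, y} \<in> E} ^^ d}"
  assume "gdist E u v \<le> 1"
  then have "\<not> enat 2 \<le> gdist E u v"
    by (metis enat_ord_simps(1) not_less_eq_eq numeral_2_eq_2 one_enat_def order_refl order_trans One_nat_def)
  then obtain d where d: "d \<in> ?D" "\<not> enat 2 \<le> enat d"
    unfolding gdist_def by (meson INF_greatest)
  then have "d = 0 \<or> d = 1"
    by auto
  with d(1) show "u = v \<or> {u, v} \<in> E"
    by auto
next
  assume "u = v \<or> {u, v} \<in> E"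
  then have "(u, v) \<in> {(x, y). {x, y} \<in> E} ^^ 0 \<or> (u, v) \<in> {(x, y). {x, y} \<in> E} ^^ 1"
    by auto
  then obtain d where d: "(u, v) \<in> {(x, y). {x, y} \<in> E} ^^ d" "d \<le> 1"
    by (metis le_refl zero_le)
  then have "gdist E u v \<le> enat d"
    unfolding gdist_def by (auto intro: INF_lower)
  also have "enat d \<le> 1"
    using d(2) by (simp add: one_enat_def)
  finally show "gdist E u v \<le> 1" .
qed

locale game =
  fixes n k :: nat and E :: "nat set set"
  assumes graph: "simple_graph n E" and n_pos: "0 < n"
begin

definition near :: "nat \<Rightarrow> nat \<Rightarrow> bool" where
  "near u v \<longleftrightarrow> u = v \<or> {u, v} \<in> E"

lemma near_sym: "near u v \<Longrightarrow> near v u"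
  by (auto simp: near_def insert_commute)

lemma near_refl [simp]: "near u u"
  by (simp add: near_def)

lemma near_range: "near u v \<Longrightarrow> u \<in> {1..n} \<Longrightarrow> v \<in> {1..n}"
  using graph by (auto simp: near_def simple_graph_def)

section \<open>Winning positions of the game with single piece moves\<close>

definition captured :: "(nat \<Rightarrow> nat) \<Rightarrow> bool" where
  "captured p \<longleftrightarrow> (\<exists>i\<in>{1..k}. p i = p 0)"

text \<open>\<open>t\<close> is the piece that moved last. Positions are arbitrary functions; ranges
  are assumed only where finiteness is used.\<close>

inductive cops_win :: "(nat \<Rightarrow> nat) \<Rightarrow> nat \<Rightarrow> bool" where
  capture: "captured p \<Longrightarrow> cops_win p t"
| cop_move: "t < k \<Longrightarrow> near (p (Suc t)) v \<Longrightarrow> cops_win (p(Suc t := v)) (Suc t) \<Longrightarrow> cops_win p t"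
| robber_move: "(\<And>v. near (p 0) v \<Longrightarrow> cops_win (p(0 := v)) 0) \<Longrightarrow> cops_win p k"

text \<open>A full round at a time: the cops move together and then the robber answers, as in
  \<open>copwin\<close>. The number of rounds is what a strategy can decrease.\<close>

primrec win_within :: "nat \<Rightarrow> (nat \<Rightarrow> nat) \<Rightarrow> bool" where
  "win_within 0 p = captured p"
| "win_within (Suc m) p = (captured p \<or> (\<exists>q. q 0 = p 0 \<and> (\<forall>i\<in>{1..k}. near (p i) (q i)) \<and>
     (captured q \<or> (\<forall>v. near (p 0) v \<longrightarrow> win_within m (q(0 := v))))))"

lemma win_within_Suc: "win_within m p \<Longrightarrow> win_within (Suc m) p"
proof (induction m arbitrary: p)
  case (Suc m)
  show ?case
  proof (cases "captured p")
    case False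
    with Suc.prems obtain q where q: "q 0 = p 0" "\<forall>i\<in>{1..k}. near (p i) (q i)"
      "captured q \<or> (\<forall>v. near (p 0) v \<longrightarrow> win_within m (q(0 := v)))"
      by auto
    then have "captured q \<or> (\<forall>v. near (p 0) v \<longrightarrow> win_within (Suc m) (q(0 := v)))"
      using Suc.IH by blast
    with q(1,2) show ?thesis
      by (metis win_within.simps(2))
  qed simp
qed simp

lemma win_within_mono: "m \<le> m' \<Longrightarrow> win_within m p \<Longrightarrow> win_within m' p"
  by (induction rule: dec_induct) (use win_within_Suc in blast)+

text \<open>For an induction over single moves the claim has to cover a turn in progress: cops
  \<open>1, ..., t\<close> have moved and keep their places, while \<open>q\<close> completes the
  turn for the others.\<close>

lemma cops_win_imp_win_within:
  assumes "cops_win p t" "\<forall>i\<le>k. p i \<in> {1..n}" "t \<le> k"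
  shows "\<exists>m q. q 0 = p 0 \<and> (\<forall>i\<in>{1..t}. q i = p i) \<and> (\<forall>i\<in>{t<..k}. near (p i) (q i)) \<and>
    (captured p \<or> captured q \<or> (\<forall>v. near (p 0) v \<longrightarrow> win_within m (q(0 := v))))"
  using assms
proof (induction rule: cops_win.induct)
  case (capture p t)
  then show ?case
    by (intro exI[of _ 0] exI[of _ p]) simp
next
  case (cop_move t p v)
  have "v \<in> {1..n}"
    using near_range[OF cop_move.hyps(2)] cop_move.prems(1) cop_move.hyps(1) by simp
  then obtain m q where q: "q 0 = (p(Suc t := v)) 0"
      "\<forall>i\<in>{1..Suc t}. q i = (p(Suc t := v)) i" "\<forall>i\<in>{Suc t<..k}. near ((p(Suc t := v)) i) (q i)"
      "captured (p(Suc t := v)) \<or> captured q \<or>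
       (\<forall>v'. near ((p(Suc t := v)) 0) v' \<longrightarrow> win_within m (q(0 := v')))"
    using cop_move.IH cop_move.prems cop_move.hyps
    by (metis Suc_leI fun_upd_apply)
  \<comment> \<open>The cop that has just moved stays put for the rest of the turn and so is still
    on the robber in \<open>q\<close>; any other capturing cop was there already in
    \<open>p\<close>.\<close>
  have "captured p \<or> captured q" if cap: "captured (p(Suc t := v))"
  proof -
    obtain i where i: "i \<in> {1..k}" "(p(Suc t := v)) i = p 0"
      using cap by (auto simp: captured_def)
    then show ?thesis
      using q(1,2) unfolding captured_def
      by (cases "i = Suc t") (auto intro!: bexI[of _ i])
  qed
  moreover have "near (p i) (q i)" if "i \<in> {t<..k}" for i
    using q(2,3) cop_move.hyps(2) that by (cases "i = Suc t") auto
  ultimately have "captured p \<or> captured q \<or> (\<forall>v. near (p 0) v \<longrightarrow> win_within m (q(0 := v)))"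
    and "\<forall>i\<in>{t<..k}. near (p i) (q i)"
    using q(4) by (metis fun_upd_other nat.distinct(1), blast)
  moreover have "q 0 = p 0" "\<forall>i\<in>{1..t}. q i = p i"
    using q(1,2) by auto
  ultimately show ?case
    by blast
next
  case (robber_move p)
  have "\<exists>m. win_within m (p(0 := v))" if v: "near (p 0) v" for v
  proof -
    have "v \<in> {1..n}"
      using near_range[OF v] robber_move.prems(1) by simp
    then have "\<forall>i\<le>k. (p(0 := v)) i \<in> {1..n}"
      using robber_move.prems(1) by simp
    from robber_move.IH[OF v this le0] obtain m q where q: "q 0 = (p(0 := v)) 0"
      "\<forall>i\<in>{0<..k}. near ((p(0 := v)) i) (q i)"
      "captured (p(0 := v)) \<or> captured q \<or>
       (\<forall>v'. near ((p(0 := v)) 0) v' \<longrightarrow> win_within m (q(0 := v')))"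
      by blast
    have "win_within (Suc m) (p(0 := v))"
      unfolding win_within.simps by (rule disjE[OF q(3)]) (use q(1,2) in \<open>auto intro!: exI[of _ q]\<close>)
    then show ?thesis ..
  qed
  then obtain M where M: "\<And>v. near (p 0) v \<Longrightarrow> win_within (M v) (p(0 := v))"
    by metis
  \<comment> \<open>The robber's options lie in \<open>{1..n}\<close>, so the largest of the
    individual bounds serves for all of them.\<close>
  have "M v \<le> Max (M ` {1..n})" if "near (p 0) v" for v
    using near_range[OF that] robber_move.prems(1) by (intro Max_ge) auto
  then have "\<forall>v. near (p 0) v \<longrightarrow> win_within (Max (M ` {1..n})) (p(0 := v))"
    using M win_within_mono by blast
  then show ?case
    by (intro exI[of _ "Max (M ` {1..n})"] exI[of _ p] conjI) (blast | simp)+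
qed

lemma cops_win_imp_ex_win_within:
  assumes "cops_win p 0" "\<forall>i\<le>k. p i \<in> {1..n}"
  shows "\<exists>m. win_within m p"
proof -
  from cops_win_imp_win_within[OF assms] obtain m q where
    q: "q 0 = p 0" "\<forall>i\<in>{0<..k}. near (p i) (q i)"
    "captured p \<or> captured q \<or> (\<forall>v. near (p 0) v \<longrightarrow> win_within m (q(0 := v)))"
    by auto
  have "win_within (Suc m) p"
    unfolding win_within.simps by (rule disjE[OF q(3)]) (use q(1,2) in \<open>auto intro!: exI[of _ q]\<close>)
  then show ?thesis ..
qed

text \<open>Choosing the move for the least possible number of rounds gives a single positional
  strategy that makes progress from every winning position.\<close>

lemma ex_progress_move:
  "\<exists>q. (\<forall>i\<in>{1..k}. near (p i) (q i)) \<and>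
    (\<forall>m. win_within m p \<longrightarrow> captured p \<or> captured (q(0 := p 0)) \<or>
       (\<exists>m'<m. \<forall>v. near (p 0) v \<longrightarrow> win_within m' (q(0 := v))))"
proof (cases "captured p \<or> (\<nexists>m. win_within m p)")
  case True
  \<comment> \<open>Staying put is the default move where no progress is required.\<close>
  then show ?thesis
    by (intro exI[of _ p]) auto
next
  case False
  define l where "l = (LEAST m. win_within m p)"
  have l: "win_within l p"
    using False unfolding l_def by (metis LeastI)
  then obtain l' where l': "l = Suc l'"
    using False by (cases l) auto
  from l False obtain q where q: "q 0 = p 0" "\<forall>i\<in>{1..k}. near (p i) (q i)"
    "captured q \<or> (\<forall>v. near (p 0) v \<longrightarrow> win_within l' (q(0 := v)))"
    unfolding l' by auto
  have "l' < m" if "win_within m p" for m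
    using Least_le[of "\<lambda>m. win_within m p", OF that] l' by (simp add: l_def)
  moreover have "q(0 := p 0) = q"
    using q(1) by auto
  ultimately show ?thesis
    using q(2,3) by (intro exI[of _ q]) auto
qed

lemma copwin_if_winning_placement:
  assumes p: "\<forall>i\<in>{1..k}. p i \<in> {1..n}"
    and win: "\<forall>v\<in>{1..n}. cops_win (p(0 := v)) 0"
  shows "copwin n E k"
proof -
  from ex_progress_move obtain mv where
    mv: "\<And>p i. i \<in> {1..k} \<Longrightarrow> near (p i) (mv p i)" and
    progress: "\<And>p m. win_within m p \<Longrightarrow> captured p \<or> captured ((mv p)(0 := p 0)) \<or>
       (\<exists>m'<m. \<forall>v. near (p 0) v \<longrightarrow> win_within m' ((mv p)(0 := v)))"
    by metis
  \<comment> \<open>A history contains the robber's positions only; folding the positional move over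
    it recovers those of the cops. Entry 0 of the accumulator is overwritten before each
    use.\<close>
  define \<sigma> where "\<sigma> = (\<lambda>xs. fold (\<lambda>x c. mv (c(0 := x))) xs p)"
  have zero: "cops_at \<sigma> r 0 = p" for r
    by (simp add: cops_at_def \<sigma>_def)
  have Suc: "cops_at \<sigma> r (Suc j) = mv ((cops_at \<sigma> r j)(0 := r j))" for r j
    by (simp add: cops_at_def \<sigma>_def)
  have near: "near (cops_at \<sigma> r j i) (cops_at \<sigma> r (Suc j) i)" if "i \<in> {1..k}" for r i j
    using mv[OF that, of "(cops_at \<sigma> r j)(0 := r j)"] that by (simp add: Suc)
  have range: "cops_at \<sigma> r j i \<in> {1..n}" if "i \<in> {1..k}" for r i j
  proof (induction j)
    case (Suc j)
    then show ?case
      using near_range[OF near[OF that]] by blast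
  qed (use p zero that in simp)
  have "legal_strategy n E k \<sigma>"
    unfolding legal_strategy_def gdist_le_1_iff
    using near range by (simp add: near_def)
  moreover have "winning_strategy n E k \<sigma>"
    unfolding winning_strategy_def
  proof (intro allI impI)
    fix r
    assume r: "robber_play n E r"
    have captures: "\<exists>j. \<exists>i\<in>{1..k}. cops_at \<sigma> r j i = r j \<or> cops_at \<sigma> r (Suc j) i = r j"
      if "win_within m ((cops_at \<sigma> r j)(0 := r j))" for m j
      using that
    proof (induction m arbitrary: j rule: less_induct)
      case (less m)
      from progress[OF less.prems] consider
        "captured ((cops_at \<sigma> r j)(0 := r j))" | "captured ((cops_at \<sigma> r (Suc j))(0 := r j))"
        | m' where "m' < m" "\<And>v. near (r j) v \<Longrightarrow> win_within m' ((cops_at \<sigma> r (Suc j))(0 := v))"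
        unfolding Suc by (metis fun_upd_same)
      then show ?case
      proof cases
        case 3
        moreover have "near (r j) (r (Suc j))"
          using r by (simp add: robber_play_def gdist_le_1_iff near_def)
        ultimately show ?thesis
          using less.IH by blast
      qed (fastforce simp: captured_def)+
    qed
    have "r 0 \<in> {1..n}"
      using r by (simp add: robber_play_def)
    then have "\<exists>m. win_within m (p(0 := r 0))"
      using win p by (intro cops_win_imp_ex_win_within) auto
    then show "\<exists>j. \<exists>i\<in>{1..k}. cops_at \<sigma> r j i = r j \<or> cops_at \<sigma> r (Suc j) i = r j"
      using captures[of _ 0] zero by auto
  qed
  ultimately show ?thesis
    unfolding copwin_def by blast
qed

text \<open>The joint move of the cops is undone one cop at a time, through the positions in which
  only cops \<open>1, ..., t\<close> have moved.\<close>

lemma cops_win_if_round: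
  assumes "cops_win q k" "\<forall>i\<in>{1..k}. near (p i) (q i)" "\<forall>i. i \<notin> {1..k} \<longrightarrow> p i = q i"
  shows "cops_win p 0"
proof -
  have "cops_win (\<lambda>i. if i \<le> t then q i else p i) t" if "t \<le> k" for t
    using that
  proof (induction rule: inc_induct)
    case base
    have "(\<lambda>i. if i \<le> k then q i else p i) = q"
      using assms(3) by auto
    then show ?case
      using assms(1) by simp
  next
    case (step t)
    have "(\<lambda>i. if i \<le> Suc t then q i else p i) = (\<lambda>i. if i \<le> t then q i else p i)(Suc t := q (Suc t))"
      by (auto simp: le_Suc_eq)
    then show ?case
      using step assms(2) by (intro cop_move[of t _ "q (Suc t)"]) auto
  qed
  from this[of 0] have "cops_win (\<lambda>i. if i = 0 then q i else p i) 0"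
    by simp
  moreover have "(\<lambda>i. if i = 0 then q i else p i) = p"
    using assms(3) by auto
  ultimately show ?thesis
    by simp
qed

text \<open>A strategy may return anything for indices outside \<open>{1..k}\<close>. Positions are
  compared as functions, so these entries are overwritten.\<close>

definition config :: "(nat \<Rightarrow> nat) \<Rightarrow> nat \<Rightarrow> nat \<Rightarrow> nat" where
  "config c v = (\<lambda>i. if i = 0 then v else if i \<le> k then c i else 0)"

text \<open>The placement is the reply to the empty history. If it failed against some vertex, the
  robber could start there and stay outside \<open>cops_win\<close> forever, and this play would
  defeat the strategy.\<close>

lemma winning_placement_if_copwin:
  assumes "copwin n E k"
  shows "\<exists>c. (\<forall>i\<in>{1..k}. c i \<in> {1..n}) \<and> (\<forall>v\<in>{1..n}. cops_win (config c v) 0)"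
proof -
  obtain \<sigma> where legal: "legal_strategy n E k \<sigma>" and winning: "winning_strategy n E k \<sigma>"
    using assms by (auto simp: copwin_def)
  have False if v0: "v0 \<in> {1..n}" "\<not> cops_win (config (\<sigma> []) v0) 0" for v0
  proof -
    define escape where "escape h v \<longleftrightarrow> near (last h) v \<and> \<not> cops_win (config (\<sigma> h) v) 0" for h v
    \<comment> \<open>Staying put when there is no escape makes \<open>r\<close> a legal play by
      construction. That an escape always exists is shown only in \<open>lose\<close>, which relies
      on the legality of the cops' replies to \<open>r\<close>.\<close>
    define f where "f h = (if \<exists>v. escape h v then SOME v. escape h v else last h)" for h
    define H where "H = rec_nat [v0] (\<lambda>_ h. h @ [f h])"
    define r where "r j = last (H j)" for j
    have H: "H 0 = [v0]" "H (Suc j) = H j @ [f (H j)]" for j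
      by (simp_all add: H_def)
    have r_Suc: "r (Suc j) = f (H j)" for j
      by (simp add: r_def H)
    have f_near: "near (last h) (f h)" for h
    proof (cases "\<exists>v. escape h v")
      case True
      then have "escape h (f h)"
        by (simp add: f_def someI_ex)
      then show ?thesis
        by (simp add: escape_def)
    qed (simp add: f_def)
    have near: "near (r j) (r (Suc j))" for j
      using f_near by (simp add: r_def H)
    have range: "r j \<in> {1..n}" for j
    proof (induction j)
      case (Suc j)
      then show ?case
        using near_range[OF near] by blast
    qed (use v0 in \<open>simp add: r_def H\<close>)
    have play: "robber_play n E r"
      using near range by (simp add: robber_play_def gdist_le_1_iff near_def)
    have hist: "map r [0..<Suc j] = H j" for j
      by (induction j) (simp_all add: r_def H)
    then have cops_Suc: "cops_at \<sigma> r (Suc j) = \<sigma> (H j)" for j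
      by (simp only: cops_at_def)
    have cops_near: "near (cops_at \<sigma> r j i) (cops_at \<sigma> r (Suc j) i)" if "i \<in> {1..k}" for i j
      using legal play that by (simp add: legal_strategy_def gdist_le_1_iff near_def)
    have round: "\<not> cops_win (config (cops_at \<sigma> r (Suc j)) (r j)) k"
      if "\<not> cops_win (config (cops_at \<sigma> r j) (r j)) 0" for j
    proof
      assume "cops_win (config (cops_at \<sigma> r (Suc j)) (r j)) k"
      then have "cops_win (config (cops_at \<sigma> r j) (r j)) 0"
        by (rule cops_win_if_round) (use cops_near in \<open>auto simp: config_def\<close>)
      with that show False ..
    qed
    have lose: "\<not> cops_win (config (cops_at \<sigma> r j) (r j)) 0" for j
    proof (induction j)
      case 0
      then show ?case
        using v0 by (simp add: cops_at_def r_def H)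
    next
      case (Suc j)
      have "(config (\<sigma> (H j)) (r j))(0 := v) = config (\<sigma> (H j)) v" for v
        by (auto simp: config_def)
      then have "\<exists>v. escape (H j) v"
        using round[OF Suc] robber_move[of "config (\<sigma> (H j)) (r j)"]
        by (auto simp: escape_def cops_Suc config_def r_def)
      then have "escape (H j) (f (H j))"
        by (simp add: f_def someI_ex)
      then show ?case
        by (simp add: escape_def cops_Suc r_Suc)
    qed
    obtain j i where i: "i \<in> {1..k}" and "cops_at \<sigma> r j i = r j \<or> cops_at \<sigma> r (Suc j) i = r j"
      using winning play unfolding winning_strategy_def by blast
    then have "captured (config (cops_at \<sigma> r j) (r j)) \<or>
        captured (config (cops_at \<sigma> r (Suc j)) (r j))"
      by (auto simp: captured_def config_def)
    then show False
      using lose[of j] round[OF lose, of j] capture by blast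
  qed
  moreover have "\<sigma> [] i \<in> {1..n}" if "i \<in> {1..k}" for i
  proof -
    \<comment> \<open>Legality constrains \<open>\<sigma>\<close> only along robber plays, so some
      play is needed to learn anything about the starting vertices.\<close>
    have "robber_play n E (\<lambda>_. 1)"
      using n_pos by (simp add: robber_play_def gdist_le_1_iff)
    then have "cops_at \<sigma> (\<lambda>_. 1) 0 i \<in> {1..n}"
      using legal that by (simp only: legal_strategy_def)
    then show ?thesis
      by (simp add: cops_at_def)
  qed
  ultimately show ?thesis
    by blast
qed

text \<open>Nobody has to move: each vertex has its own cop, and the surplus cops wait at vertex
  1.\<close>

lemma copwin_if_many_cops:
  assumes "n \<le> k"
  shows "copwin n E k"
  unfolding copwin_def
proof (intro exI conjI)
  let ?\<sigma> = "\<lambda>_ i. if i \<le> n then i else 1"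
  show "legal_strategy n E k ?\<sigma>"
    using n_pos by (auto simp: legal_strategy_def cops_at_def gdist_le_1_iff)
  show "winning_strategy n E k ?\<sigma>"
    unfolding winning_strategy_def
  proof (intro allI impI)
    fix r
    assume "robber_play n E r"
    then have "r 0 \<in> {1..n}"
      by (simp add: robber_play_def)
    then show "\<exists>j. \<exists>i\<in>{1..k}. cops_at ?\<sigma> r j i = r j \<or> cops_at ?\<sigma> r (Suc j) i = r j"
      using assms by (intro exI[of _ 0] bexI[of _ "r 0"]) (auto simp: cops_at_def)
  qed
qed

end

section \<open>Correctness of the algorithm\<close>

locale algorithm = game n k E for n k :: nat and E :: "nat set set" +
  fixes A :: "nat \<Rightarrow> nat list"
  assumes lists: "adjacency_lists n E A"
begin

text \<open>The vertex itself comes first, as in the scan of the program, where index 0 stands for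
  the piece not moving.\<close>

definition nbs :: "nat \<Rightarrow> nat list" where
  "nbs v = v # A v"

lemma set_nbs: "v \<in> {1..n} \<Longrightarrow> set (nbs v) = {u. near v u}"
  using lists by (auto simp: adjacency_lists_def near_def nbs_def)

text \<open>An edge has two elements, so no vertex is in its own list. Hence a counter, initially a
  list length, is a number of distinct moves.\<close>

lemma distinct_nbs: "v \<in> {1..n} \<Longrightarrow> distinct (nbs v)"
  using lists graph by (auto simp: adjacency_lists_def nbs_def simple_graph_def)

lemma length_nbs: "length (nbs v) = Suc (length (A v))"
  by (simp add: nbs_def)

lemma degree_eq: "v \<in> {1..n} \<Longrightarrow> degree E v = length (A v)"
  using lists distinct_card[of "A v"] by (simp add: adjacency_lists_def degree_def)

subsection \<open>Codes of states\<close>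

definition block :: nat where
  "block = n ^ (k + 1)"

definition total :: nat where
  "total = (k + 1) * block"

definition last_moved :: "nat \<Rightarrow> nat" where
  "last_moved s = s div block"

definition pos :: "nat \<Rightarrow> nat \<Rightarrow> nat" where
  "pos s i = s div n ^ i mod n + 1"

text \<open>The value 0 beyond \<open>k\<close> makes this extensional: a code is determined by this
  function together with \<open>last_moved\<close>.\<close>

definition position :: "nat \<Rightarrow> nat \<Rightarrow> nat" where
  "position s i = (if i \<le> k then pos s i else 0)"

definition recode :: "nat \<Rightarrow> nat \<Rightarrow> nat \<Rightarrow> nat \<Rightarrow> nat" where
  "recode s t' i v = t' * block + (s mod block - (pos s i - 1) * n ^ i) + (v - 1) * n ^ i"

lemma block_pos [simp]: "0 < block"
  using n_pos by (simp add: block_def)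

lemma pos_range: "pos s i \<in> {1..n}"
  using n_pos by (simp add: pos_def Suc_leI)

lemma last_moved_le: "s < total \<Longrightarrow> last_moved s \<le> k"
  by (simp add: last_moved_def total_def less_mult_imp_div_less flip: less_Suc_eq_le)

lemma pos_mod_block: "i \<le> k \<Longrightarrow> (s mod block) div n ^ i mod n = s div n ^ i mod n"
  unfolding block_def using n_pos by (intro digit_mod_power) auto

lemma code_eqI:
  assumes "position s = position s'" "last_moved s = last_moved s'"
  shows "s = s'"
proof -
  have "s mod n ^ (k + 1) = s' mod n ^ (k + 1)"
  proof (rule mod_power_eqI)
    fix i
    assume "i < k + 1"
    then show "s div n ^ i mod n = s' div n ^ i mod n"
      using fun_cong[OF assms(1), of i] by (simp add: position_def pos_def)
  qed
  then show ?thesis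
    using assms(2) unfolding last_moved_def block_def by (metis div_mult_mod_eq)
qed

lemma recode:
  assumes "i \<le> k" "v \<in> {1..n}"
  shows "last_moved (recode s t' i v) = t'"
    and "position (recode s t' i v) = (position s)(i := v)"
    and "t' \<le> k \<Longrightarrow> recode s t' i v < total"
proof -
  define y where "y = s mod block - (s mod block div n ^ i mod n) * n ^ i + (v - 1) * n ^ i"
  have v: "v - 1 < n"
    using assms by auto
  note y = replace_digit[OF v, where x = "s mod block" and t = i, folded y_def]
  have code: "recode s t' i v = t' * block + y"
    using assms by (simp add: recode_def y_def pos_def pos_mod_block)
  \<comment> \<open>Replacing digit \<open>i\<close> must not spill over into the last component:
    the quotient by \<open>n ^ Suc i\<close> is unchanged, and it is below
    \<open>n ^ (k - i)\<close>.\<close>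
  have "block = n ^ (k - i) * n ^ Suc i"
    using assms unfolding block_def by (simp flip: power_add power_Suc)
  moreover have "y div n ^ Suc i < n ^ (k - i)"
    unfolding y(3) by (rule less_mult_imp_div_less) (metis calculation block_pos mod_less_divisor)
  ultimately have "y < block"
    using n_pos by (simp add: div_less_iff_less_mult)
  then show lm: "last_moved (recode s t' i v) = t'"
    by (simp add: last_moved_def code)
  have mod: "recode s t' i v mod block = y"
    using \<open>y < block\<close> by (simp add: code)
  show "recode s t' i v < total" if "t' \<le> k"
  proof -
    have "recode s t' i v < Suc t' * block"
      using \<open>y < block\<close> by (simp add: code)
    also have "\<dots> \<le> total"
      unfolding total_def by (rule mult_le_mono1) (use that in simp)
    finally show ?thesis .
  qed
  show "position (recode s t' i v) = (position s)(i := v)"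
  proof
    fix j
    have "y div n ^ j mod n = (if j = i then v - 1 else s div n ^ j mod n)" if "j \<le> k"
    proof (cases j i rule: linorder_cases)
      case less
      then show ?thesis
        using y(1) pos_mod_block[OF that, of s] by simp
    next
      case equal
      then show ?thesis
        using y(2) by simp
    next
      case greater
      then show ?thesis
        using y(4) pos_mod_block[OF that, of s] by simp
    qed
    then show "position (recode s t' i v) j = ((position s)(i := v)) j"
      using pos_mod_block[of j "recode s t' i v"] assms
      by (auto simp: position_def pos_def mod)
  qed
qed

lemma pos_eq_position: "i \<le> k \<Longrightarrow> pos s i = position s i"
  by (simp add: position_def)

lemma position_upd_pos: "i \<le> k \<Longrightarrow> (position s)(i := v, i := pos s i) = position s"
  by (simp add: pos_eq_position)

lemma ex_code:
  assumes "\<forall>i\<le>k. p i \<in> {1..n}" "\<forall>i>k. p i = 0" "t \<le> k"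
  shows "\<exists>s<total. last_moved s = t \<and> position s = p"
proof -
  have "\<exists>s<total. last_moved s = t \<and> (\<forall>i<m. position s i = p i)" if "m \<le> Suc k" for m
    using that
  proof (induction m)
    case 0
    have "t * block < total"
      unfolding total_def using assms(3) by (intro mult_strict_right_mono) auto
    then show ?case
      by (intro exI[of _ "t * block"]) (simp add: last_moved_def)
  next
    case (Suc m)
    then obtain s where "s < total" "last_moved s = t" "\<forall>i<m. position s i = p i"
      by auto
    then show ?case
      using Suc.prems assms recode[where i = m and v = "p m" and s = s and t' = t]
      by (intro exI[of _ "recode s t m (p m)"]) (auto simp: less_Suc_eq)
  qed
  from this[of "Suc k"] obtain s where
    "s < total" "last_moved s = t" "\<forall>i<Suc k. position s i = p i"
    by auto
  moreover from this(3) have "position s = p"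
    using assms(2) by (auto simp: position_def fun_eq_iff less_Suc_eq_le not_le)
  ultimately show ?thesis
    by blast
qed

text \<open>The in-neighbours of a code \<open>s\<close> are \<open>pred s v\<close>, and the out-neighbours of a code \<open>q\<close> with
  the robber to move are \<open>succ q v\<close>, for \<open>v\<close> in the closed neighbourhood of the moving piece.\<close>

definition pred :: "nat \<Rightarrow> nat \<Rightarrow> nat" where
  "pred s v = recode s ((last_moved s + k) mod (k + 1)) (last_moved s) v"

definition moves :: "nat \<Rightarrow> nat list" where
  "moves s = nbs (pos s (last_moved s))"

definition succ :: "nat \<Rightarrow> nat \<Rightarrow> nat" where
  "succ q v = recode q 0 0 v"

definition robber_moves :: "nat \<Rightarrow> nat list" where
  "robber_moves q = nbs (pos q 0)"

definition win :: "nat \<Rightarrow> bool" where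
  "win s \<longleftrightarrow> cops_win (position s) (last_moved s)"

definition capt :: "nat \<Rightarrow> bool" where
  "capt s \<longleftrightarrow> (\<exists>i\<in>{1..k}. pos s i = pos s 0)"

lemma capt_iff: "capt s \<longleftrightarrow> captured (position s)"
  by (simp add: capt_def captured_def position_def)

lemma win_if_capt: "capt s \<Longrightarrow> win s"
  by (simp add: capt_iff win_def capture)

lemma set_moves: "set (moves s) = {v. near (pos s (last_moved s)) v}"
  unfolding moves_def by (rule set_nbs[OF pos_range])

lemma set_robber_moves: "set (robber_moves s) = {v. near (pos s 0) v}"
  unfolding robber_moves_def by (rule set_nbs[OF pos_range])

lemma moves_range: "v \<in> set (moves s) \<Longrightarrow> v \<in> {1..n}"
  using near_range[OF _ pos_range] by (auto simp: set_moves)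

lemma robber_moves_range: "v \<in> set (robber_moves s) \<Longrightarrow> v \<in> {1..n}"
  using near_range[OF _ pos_range] by (auto simp: set_robber_moves)

lemma pred:
  assumes "s < total" "v \<in> set (moves s)"
  shows "pred s v < total"
    and "position (pred s v) = (position s)(last_moved s := v)"
    and "last_moved (pred s v) = (if last_moved s = 0 then k else last_moved s - 1)"
proof -
  note r = recode[OF last_moved_le[OF assms(1)] moves_range[OF assms(2)]]
  have "(last_moved s + k) mod (k + 1) = (if last_moved s = 0 then k else last_moved s - 1)"
  proof (cases "last_moved s = 0")
    case False
    then have "last_moved s + k = (last_moved s - 1) + (k + 1)"
      by simp
    then have "(last_moved s + k) mod (k + 1) = (last_moved s - 1) mod (k + 1)"
      by (metis mod_add_self2)
    then show ?thesis
      using False last_moved_le[OF assms(1)] by simp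
  qed simp
  with r show "pred s v < total" "position (pred s v) = (position s)(last_moved s := v)"
    "last_moved (pred s v) = (if last_moved s = 0 then k else last_moved s - 1)"
    using last_moved_le[OF assms(1)] by (auto simp: pred_def)
qed

lemma succ:
  assumes "v \<in> set (robber_moves q)"
  shows "succ q v < total" "position (succ q v) = (position q)(0 := v)" "last_moved (succ q v) = 0"
  using recode[OF le0 robber_moves_range[OF assms], where s = q and t' = 0] by (simp_all add: succ_def)

lemma inj_pred: "s < total \<Longrightarrow> inj_on (pred s) (set (moves s))"
  using pred(2) by (intro inj_onI) (metis fun_upd_same)

lemma inj_succ: "inj_on (succ q) (set (robber_moves q))"
  using succ(2) by (intro inj_onI) (metis fun_upd_same)

text \<open>A robber move is undone by sending him back to \<open>pos s 0\<close>. This is the move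
  through which \<open>s\<close> is counted at \<open>pred s v\<close>.\<close>

lemma succ_pred:
  assumes "s < total" "v \<in> set (moves s)" "last_moved s = 0"
  shows "pos s 0 \<in> set (robber_moves (pred s v))" and "succ (pred s v) (pos s 0) = s"
proof -
  have "pos (pred s v) 0 = v"
    using pred(2)[OF assms(1,2)] assms(3) by (simp add: pos_eq_position)
  then show *: "pos s 0 \<in> set (robber_moves (pred s v))"
    using assms near_sym by (auto simp: set_robber_moves set_moves)
  show "succ (pred s v) (pos s 0) = s"
    by (rule code_eqI)
      (simp_all only: succ[OF *] pred[OF assms(1,2)] assms(3) position_upd_pos[OF le0])
qed

lemma pred_succ:
  assumes "q < total" "last_moved q = k" "v \<in> set (robber_moves q)"
  shows "pos q 0 \<in> set (moves (succ q v))" and "pred (succ q v) (pos q 0) = q"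
proof -
  note s = succ[OF assms(3)]
  have "pos (succ q v) 0 = v"
    using s(2) by (simp add: pos_eq_position)
  then show *: "pos q 0 \<in> set (moves (succ q v))"
    using assms(3) near_sym by (auto simp: set_robber_moves set_moves s)
  show "pred (succ q v) (pos q 0) = q"
    by (rule code_eqI)
      (simp_all only: pred[OF s(1) *] s assms(2) position_upd_pos[OF le0] refl if_True)
qed

section \<open>The winning set in terms of codes\<close>

lemma win_pred:
  assumes "s < total" "last_moved s \<noteq> 0" "win s" "v \<in> set (moves s)"
  shows "win (pred s v)"
proof -
  let ?t = "last_moved s"
  note p = pred[OF assms(1,4)]
  have t: "Suc (?t - 1) = ?t" "?t \<le> k"
    using assms last_moved_le by auto
  have "cops_win (((position s)(?t := v))(Suc (?t - 1) := pos s ?t)) (Suc (?t - 1))"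
    unfolding t(1) position_upd_pos[OF t(2)] using assms(3) by (simp add: win_def)
  moreover have "near v (pos s ?t)"
    using assms(4) near_sym by (simp add: set_moves)
  ultimately show ?thesis
    unfolding win_def p(2,3) if_not_P[OF assms(2)] using assms(2) t
    by (intro cop_move[of "?t - 1" "(position s)(?t := v)" "pos s ?t"]) simp_all
qed

lemma win_if_succ:
  assumes "last_moved q = k" "\<forall>v\<in>set (robber_moves q). win (succ q v)"
  shows "win q"
  unfolding win_def assms(1)
proof (rule robber_move)
  fix v
  assume "near (position q 0) v"
  then have "v \<in> set (robber_moves q)"
    by (simp add: set_robber_moves pos_eq_position)
  then show "cops_win ((position q)(0 := v)) 0"
    using assms(2) succ[of v q] by (auto simp: win_def)
qed

text \<open>Rule induction for \<open>cops_win\<close>, carried over to codes: every position that a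
  rule refers to has a code, reached by \<open>recode\<close> or \<open>succ\<close>. It will be
  applied to the set of marked codes.\<close>

lemma win_closed:
  assumes capt: "\<And>s. s < total \<Longrightarrow> capt s \<Longrightarrow> s \<in> M"
    and cop: "\<And>s v. s < total \<Longrightarrow> s \<in> M \<Longrightarrow> last_moved s \<noteq> 0 \<Longrightarrow> v \<in> set (moves s) \<Longrightarrow> pred s v \<in> M"
    and rob: "\<And>q. q < total \<Longrightarrow> last_moved q = k \<Longrightarrow> \<forall>v\<in>set (robber_moves q). succ q v \<in> M \<Longrightarrow> q \<in> M"
    and "s < total" "win s"
  shows "s \<in> M"
proof -
  have "cops_win p t \<Longrightarrow> s < total \<Longrightarrow> position s = p \<Longrightarrow> last_moved s = t \<Longrightarrow> s \<in> M" for p t s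
  proof (induction arbitrary: s rule: cops_win.induct)
    case (capture p t)
    then show ?case
      using capt by (simp add: capt_iff)
  next
    case (cop_move t p v)
    have near: "near (pos s (Suc t)) v"
      using cop_move by (simp add: pos_eq_position)
    then have v: "v \<in> {1..n}"
      using near_range pos_range by blast
    \<comment> \<open>The code after the cop's move; returning the cop to
      \<open>pos s (Suc t)\<close> is the arc back to \<open>s\<close>.\<close>
    define s' where "s' = recode s (Suc t) (Suc t) v"
    have s': "last_moved s' = Suc t" "position s' = p(Suc t := v)" "s' < total"
      using recode[where i = "Suc t" and v = v and s = s and t' = "Suc t"] cop_move v by (auto simp: s'_def)
    then have m: "s' \<in> M"
      using cop_move.IH by blast
    have "pos s' (Suc t) = v"
      using s' cop_move.hyps(1) by (simp add: pos_eq_position)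
    then have u: "pos s (Suc t) \<in> set (moves s')"
      using near near_sym s' by (simp add: set_moves)
    have "position (pred s' (pos s (Suc t))) = position s"
      by (simp only: pred(2)[OF s'(3) u] s'(1,2) cop_move.prems(2)[symmetric]
          position_upd_pos[OF Suc_leI[OF cop_move.hyps(1)]])
    then have "pred s' (pos s (Suc t)) = s"
      using pred(3)[OF s'(3) u] s'(1) cop_move.prems by (simp add: code_eqI)
    then show ?case
      using cop[OF s'(3) m _ u] s'(1) by simp
  next
    case (robber_move p)
    have "succ s v \<in> M" if "v \<in> set (robber_moves s)" for v
      using robber_move.IH[of v "succ s v"] robber_move.prems succ[OF that] that
      by (simp add: set_robber_moves pos_eq_position)
    then show ?case
      using rob robber_move.prems by blast
  qed
  then show ?thesis
    using assms(4,5) by (auto simp: win_def)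
qed

lemma copwin_iff_code:
  "copwin n E k \<longleftrightarrow> (\<exists>c<n ^ k. \<forall>p\<in>{1..n}. win ((p - 1) + n * c))"
proof
  have code: "last_moved ((p - 1) + n * c) = 0"
    "position ((p - 1) + n * c) = (position (n * c))(0 := p)"
    if "c < n ^ k" "p \<in> {1..n}" for c p
  proof -
    have "n * c < block"
      using that n_pos by (simp add: block_def)
    then have "recode (n * c) 0 0 p = (p - 1) + n * c"
      by (simp add: recode_def pos_def)
    then show "last_moved ((p - 1) + n * c) = 0"
      "position ((p - 1) + n * c) = (position (n * c))(0 := p)"
      using recode[where i = 0 and v = p and s = "n * c" and t' = 0] that by auto
  qed
  {
    assume "copwin n E k"
    then obtain c where c: "\<forall>i\<in>{1..k}. c i \<in> {1..n}" "\<forall>v\<in>{1..n}. cops_win (config c v) 0"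
      using winning_placement_if_copwin by blast
    \<comment> \<open>A robber on vertex 1 gives digit 0, so the code is a multiple of
      \<open>n\<close>, and its quotient by \<open>n\<close> is the number of the placement.\<close>
    have "\<forall>i\<le>k. config c 1 i \<in> {1..n}"
      using c(1) n_pos by (auto simp: config_def Suc_le_eq)
    then obtain s where s: "last_moved s = 0" "position s = config c 1"
      using ex_code[of "config c 1" 0] by (auto simp: config_def)
    have "pos s 0 = 1"
      using s(2) by (simp add: pos_eq_position config_def)
    then have sc: "s = n * (s div n)"
      by (simp add: pos_def) (metis mod_0_imp_dvd dvd_mult_div_cancel)
    have "s < block"
      using s(1) using block_pos by (simp add: last_moved_def div_eq_0_iff)
    then have "s div n < n ^ k"
      using n_pos by (simp add: block_def div_less_iff_less_mult mult.commute)
    moreover have "win ((p - 1) + n * (s div n))" if "p \<in> {1..n}" for p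
    proof -
      have "(config c 1)(0 := p) = config c p"
        by (auto simp: config_def)
      then show ?thesis
        using code[OF calculation that] c(2) that s(2) unfolding win_def by (simp flip: sc)
    qed
    ultimately show "\<exists>c<n ^ k. \<forall>p\<in>{1..n}. win ((p - 1) + n * c)"
      by blast
  next
    assume "\<exists>c<n ^ k. \<forall>p\<in>{1..n}. win ((p - 1) + n * c)"
    then obtain c where "c < n ^ k" "\<forall>p\<in>{1..n}. win ((p - 1) + n * c)"
      by blast
    then show "copwin n E k"
      using code pos_range by (intro copwin_if_winning_placement[of "position (n * c)"])
        (auto simp: win_def position_def)
  }
qed

subsection \<open>Invariants of the queue\<close>

text \<open>Dequeued cells are not erased, so the first \<open>e\<close> cells are a log of all
  marked codes. Injectivity says that each was enqueued once, which bounds both the queue and the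
  cost.\<close>

definition marks_inv :: "nat \<Rightarrow> (nat \<Rightarrow> nat) \<Rightarrow> (nat \<Rightarrow> nat) \<Rightarrow> bool" where
  "marks_inv e qu cp \<longleftrightarrow> inj_on qu {..<e} \<and> qu ` {..<e} = {s. s < total \<and> cp s \<noteq> 0} \<and>
     (\<forall>s<total. cp s \<noteq> 0 \<longrightarrow> win s)"

definition captures_marked :: "(nat \<Rightarrow> nat) \<Rightarrow> bool" where
  "captures_marked cp \<longleftrightarrow> (\<forall>s<total. capt s \<longrightarrow> cp s \<noteq> 0)"

definition preds_marked :: "(nat \<Rightarrow> nat) \<Rightarrow> nat set \<Rightarrow> bool" where
  "preds_marked cp D \<longleftrightarrow>
     (\<forall>s\<in>D. last_moved s \<noteq> 0 \<longrightarrow> (\<forall>v\<in>set (moves s). cp (pred s v) \<noteq> 0))"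

text \<open>The set of processed codes may depend on \<open>q\<close>, because in the middle of a
  scan only some of the counters have been decremented. The last clause makes up for marking being
  triggered only by a decrement.\<close>

definition counters_inv :: "(nat \<Rightarrow> nat) \<Rightarrow> (nat \<Rightarrow> nat) \<Rightarrow> (nat \<Rightarrow> nat set) \<Rightarrow> bool" where
  "counters_inv ct cp D \<longleftrightarrow> (\<forall>q<total. last_moved q = k \<longrightarrow>
     ct q = card {v \<in> set (robber_moves q). succ q v \<notin> D q} \<and> (ct q = 0 \<longrightarrow> cp q \<noteq> 0))"

definition queue_inv where
  "queue_inv h e qu cp ct \<longleftrightarrow> h \<le> e \<and> marks_inv e qu cp \<and> captures_marked cp \<and>
     preds_marked cp (qu ` {..<h}) \<and> counters_inv ct cp (\<lambda>_. qu ` {..<h})"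

text \<open>The invariant while the in-neighbours of \<open>s\<close> are scanned: in the counters of the first \<open>j\<close>
  of them \<open>s\<close> already counts as processed.\<close>

definition scan_inv where
  "scan_inv h D s j e qu cp ct \<longleftrightarrow> h < e \<and> qu h = s \<and> qu ` {..<h} = D \<and>
     marks_inv e qu cp \<and> captures_marked cp \<and> preds_marked cp D \<and>
     (last_moved s \<noteq> 0 \<longrightarrow> (\<forall>v\<in>set (take j (moves s)). cp (pred s v) \<noteq> 0)) \<and>
     counters_inv ct cp (\<lambda>q. if last_moved s = 0 \<and> q \<in> pred s ` set (take j (moves s))
       then insert s D else D)"

section \<open>Preservation of the invariants by dequeuing and marking\<close>

lemma marks_inv_less: "marks_inv e qu cp \<Longrightarrow> i < e \<Longrightarrow> qu i < total \<and> cp (qu i) \<noteq> 0 \<and> win (qu i)"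
  unfolding marks_inv_def by blast

text \<open>The queue is filled with distinct codes below \<open>total\<close>. Hence the head is
  below \<open>total\<close> while the queue is nonempty, and the main loop ends.\<close>

lemma marks_inv_le_total: "marks_inv e qu cp \<Longrightarrow> e \<le> total"
  unfolding marks_inv_def
  by (metis (no_types, lifting) card_image card_lessThan card_mono finite_lessThan lessThan_iff
      mem_Collect_eq subsetI)

lemma marks_inv_enqueue:
  assumes inv: "marks_inv e qu cp" and q: "q < total" "cp q = 0" "win q"
  shows "marks_inv (Suc e) (qu(e := q)) (cp(q := Suc 0))"
proof -
  have "qu i \<noteq> q" if "i < e" for i
    using marks_inv_less[OF inv that] q by auto
  then have "inj_on (qu(e := q)) {..<Suc e}"
    using inv by (auto simp: marks_inv_def inj_on_def less_Suc_eq) blast+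
  moreover have "(qu(e := q)) ` {..<Suc e} = insert q (qu ` {..<e})"
    by (auto simp: lessThan_Suc)
  then have "(qu(e := q)) ` {..<Suc e} = {s. s < total \<and> (cp(q := Suc 0)) s \<noteq> 0}"
    using inv q by (auto simp: marks_inv_def)
  ultimately show ?thesis
    using inv q by (simp add: marks_inv_def)
qed

text \<open>New marks can only help the closure conditions, and cell \<open>e\<close> lies behind
  the processed part of the queue, which therefore does not change.\<close>

lemma scan_inv_enqueue:
  assumes "scan_inv h D s j e qu cp ct" "q < total" "cp q = 0" "win q"
  shows "scan_inv h D s j (Suc e) (qu(e := q)) (cp(q := Suc 0)) ct"
proof -
  have "(qu(e := q)) ` {..<h} = qu ` {..<h}"
    using assms(1) by (intro image_cong) (auto simp: scan_inv_def)
  then show ?thesis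
    using assms marks_inv_enqueue[of e qu cp q] unfolding scan_inv_def
    by (auto simp: captures_marked_def preds_marked_def counters_inv_def)
qed

lemma scan_start:
  "queue_inv h e qu cp ct \<Longrightarrow> h < e \<Longrightarrow> scan_inv h (qu ` {..<h}) (qu h) 0 e qu cp ct"
  unfolding queue_inv_def scan_inv_def by simp

lemma scan_facts:
  assumes "scan_inv h D s j e qu cp ct"
  shows "s < total" "s \<notin> D" "finite D" "\<forall>s'\<in>insert s D. s' < total \<and> win s'"
proof -
  have m: "marks_inv e qu cp" and l: "h < e" and D: "D = qu ` {..<h}" "s = qu h"
    using assms by (auto simp: scan_inv_def)
  show "s < total" "finite D" "\<forall>s'\<in>insert s D. s' < total \<and> win s'"
    using marks_inv_less[OF m] l D by auto
  show "s \<notin> D"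
    using m l unfolding D marks_inv_def by (auto dest: inj_onD)
qed

text \<open>A code with the robber to move and a move to \<open>s\<close> is an in-neighbour of
  \<open>s\<close> by \<open>pred_succ\<close>, so after the scan every counter that concerns
  \<open>s\<close> has been decremented.\<close>

lemma scan_end:
  assumes "scan_inv h D s (length (moves s)) e qu cp ct"
  shows "queue_inv (Suc h) e qu cp ct" "qu ` {..<Suc h} = insert s D"
proof -
  show D: "qu ` {..<Suc h} = insert s D"
    using assms by (auto simp: scan_inv_def lessThan_Suc)
  have "(\<exists>v\<in>set (robber_moves q). succ q v = s) \<longrightarrow>
      last_moved s = 0 \<and> q \<in> pred s ` set (moves s)" if "q < total" "last_moved q = k" for q
    using pred_succ[OF that] succ by (metis image_eqI)
  then have "{v \<in> set (robber_moves q).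
      succ q v \<notin> (if last_moved s = 0 \<and> q \<in> pred s ` set (moves s) then insert s D else D)} =
    {v \<in> set (robber_moves q). succ q v \<notin> insert s D}"
    if "q < total" "last_moved q = k" for q
    using that by (auto simp: succ(3))
  then have "counters_inv ct cp (\<lambda>_. insert s D)"
    using assms unfolding scan_inv_def counters_inv_def by simp
  then show "queue_inv (Suc h) e qu cp ct"
    using assms unfolding queue_inv_def D scan_inv_def by (simp add: preds_marked_def)
qed

lemma scan_cop_marked:
  assumes "scan_inv h D s j e qu cp ct" "last_moved s \<noteq> 0" "j < length (moves s)"
    and "cp (pred s (moves s ! j)) \<noteq> 0"
  shows "scan_inv h D s (Suc j) e qu cp ct"
  using assms unfolding scan_inv_def by (auto simp: take_Suc_conv_app_nth)

lemma scan_cop_unmarked: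
  assumes "scan_inv h D s j e qu cp ct" "last_moved s \<noteq> 0" "j < length (moves s)"
    and q: "q = pred s (moves s ! j)" "cp q = 0"
  shows "scan_inv h D s (Suc j) (Suc e) (qu(e := q)) (cp(q := Suc 0)) ct"
proof -
  note f = scan_facts[OF assms(1)]
  have "moves s ! j \<in> set (moves s)"
    using assms(3) by simp
  then have "q < total" "win q"
    using pred(1)[OF f(1)] win_pred[OF f(1) assms(2)] f(4) q by auto
  then show ?thesis
    using scan_cop_marked[OF scan_inv_enqueue[OF assms(1)]] assms by simp
qed

text \<open>Exactly one robber move leads from \<open>q\<close> to \<open>s\<close>, and
  \<open>q\<close> is met once in the scan, so one decrement is right. When the counter reaches 0,
  all successors of \<open>q\<close> have been dequeued or are \<open>s\<close>, hence are won. The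
  condition \<open>ct q \<le> Suc 0\<close> says that the decremented value is 0.\<close>

lemma scan_robber:
  assumes inv: "scan_inv h D s j e qu cp ct" and s0: "last_moved s = 0"
    and j: "j < length (moves s)" and q: "q = pred s (moves s ! j)"
  defines "ct' \<equiv> ct(q := ct q - Suc 0)"
  shows "\<not> (ct q \<le> Suc 0 \<and> cp q = 0) \<Longrightarrow> scan_inv h D s (Suc j) e qu cp ct'"
    and "ct q \<le> Suc 0 \<Longrightarrow> cp q = 0 \<Longrightarrow>
      scan_inv h D s (Suc j) (Suc e) (qu(e := q)) (cp(q := Suc 0)) ct'"
proof -
  note f = scan_facts[OF inv]
  let ?v = "moves s ! j"
  have v: "?v \<in> set (moves s)"
    using j by simp
  have q_less: "q < total" and q_last: "last_moved q = k"
    using pred[OF f(1) v] s0 q by auto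
  note u = succ_pred[OF f(1) v s0, folded q]
  have take: "set (take (Suc j) (moves s)) = insert ?v (set (take j (moves s)))"
    using j by (simp add: take_Suc_conv_app_nth)
  have "distinct (take (Suc j) (moves s))"
    using distinct_nbs[OF pos_range] by (simp add: moves_def)
  then have "?v \<notin> set (take j (moves s))"
    using j by (simp add: take_Suc_conv_app_nth)
  then have fresh: "q \<notin> pred s ` set (take j (moves s))"
    using inj_onD[OF inj_pred[OF f(1)] _ v] in_set_takeD unfolding q by fastforce
  let ?D = "\<lambda>j q. if last_moved s = 0 \<and> q \<in> pred s ` set (take j (moves s)) then insert s D else D"
  have counters: "counters_inv ct cp (?D j)"
    using inv by (simp add: scan_inv_def)
  have old: "ct q = card {v \<in> set (robber_moves q). succ q v \<notin> D}"
    using counters q_less q_last fresh by (simp add: counters_inv_def)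
  have "succ q v = s \<longleftrightarrow> v = pos s 0" if "v \<in> set (robber_moves q)" for v
    using inj_onD[OF inj_succ _ that u(1)] u(2) by (metis (no_types))
  then have "{v \<in> set (robber_moves q). succ q v \<notin> insert s D} =
      {v \<in> set (robber_moves q). succ q v \<notin> D} - {pos s 0}"
    by auto
  then have new: "ct' q = card {v \<in> set (robber_moves q). succ q v \<notin> insert s D}"
    using u f(2) unfolding ct'_def old by (simp add: card_Diff_singleton)
  have D: "?D (Suc j) q' = (if q' = q then insert s D else ?D j q')" for q'
    using s0 by (auto simp: take q)
  \<comment> \<open>Both branches at once: \<open>cp'\<close> is the marking afterwards, with or
    without \<open>q\<close> added.\<close>
  have step: "counters_inv ct' cp' (?D (Suc j))"
    if "cp' q = 0 \<Longrightarrow> ct' q \<noteq> 0" "\<And>q. cp q \<noteq> 0 \<Longrightarrow> cp' q \<noteq> 0" for cp'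
    unfolding counters_inv_def
  proof (intro allI impI)
    fix q'
    assume q': "q' < total" "last_moved q' = k"
    show "ct' q' = card {v \<in> set (robber_moves q'). succ q' v \<notin> ?D (Suc j) q'} \<and>
        (ct' q' = 0 \<longrightarrow> cp' q' \<noteq> 0)"
    proof (cases "q' = q")
      case True
      then show ?thesis
        using new that(1) unfolding D by auto
    next
      case False
      then have eq: "ct' q' = ct q'" "?D (Suc j) q' = ?D j q'"
        unfolding D by (simp_all add: ct'_def)
      show ?thesis
        using counters q' that(2) unfolding counters_inv_def eq by blast
    qed
  qed
  show "scan_inv h D s (Suc j) e qu cp ct'" if "\<not> (ct q \<le> Suc 0 \<and> cp q = 0)"
    using inv s0 step[of cp] that unfolding scan_inv_def by (auto simp: ct'_def)
  show "scan_inv h D s (Suc j) (Suc e) (qu(e := q)) (cp(q := Suc 0)) ct'"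
    if "ct q \<le> Suc 0" "cp q = 0"
  proof -
    have "card {v \<in> set (robber_moves q). succ q v \<notin> insert s D} = 0"
      using that new by (simp add: ct'_def)
    then have "\<forall>v\<in>set (robber_moves q). succ q v \<in> insert s D"
      by (subst (asm) card_0_eq) auto
    then have "win q"
      using f(4) q_last by (intro win_if_succ) auto
    then have "scan_inv h D s j (Suc e) (qu(e := q)) (cp(q := Suc 0)) ct"
      using scan_inv_enqueue inv q_less that by blast
    then show ?thesis
      using s0 step[of "cp(q := Suc 0)"] unfolding scan_inv_def by auto
  qed
qed

text \<open>With an empty queue the dequeued and the marked codes coincide, so the invariants become
  the closure conditions of \<open>win_closed\<close>.\<close>

lemma queue_inv_finished:
  assumes inv: "queue_inv h e qu cp ct" and "e \<le> h" "s < total"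
  shows "cp s \<noteq> 0 \<longleftrightarrow> win s"
proof
  have m: "marks_inv e qu cp" and D: "h = e"
    using assms by (auto simp: queue_inv_def)
  show "cp s \<noteq> 0 \<Longrightarrow> win s"
    using m assms(3) by (simp add: marks_inv_def)
  define M where "M = {s. s < total \<and> cp s \<noteq> 0}"
  have M: "qu ` {..<h} = M"
    using m by (simp add: M_def marks_inv_def D)
  have inv': "captures_marked cp" "preds_marked cp M" "counters_inv ct cp (\<lambda>_. M)"
    using inv by (simp_all add: queue_inv_def M)
  assume "win s"
  have "s \<in> M"
  proof (rule win_closed)
    show "s \<in> M" if "s < total" "capt s" for s
      using inv'(1) that by (simp add: captures_marked_def M_def)
    show "pred s v \<in> M" if "s < total" "s \<in> M" "last_moved s \<noteq> 0" "v \<in> set (moves s)" for s v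
      using inv'(2) pred(1) that by (simp add: preds_marked_def M_def)
    show "q \<in> M" if "q < total" "last_moved q = k" "\<forall>v\<in>set (robber_moves q). succ q v \<in> M" for q
    proof -
      have "{v \<in> set (robber_moves q). succ q v \<notin> M} = {}"
        using that by blast
      then show ?thesis
        using inv'(3) that(1,2) by (simp only: counters_inv_def M_def) simp
    qed
  qed fact+
  then show "cp s \<noteq> 0"
    by (simp add: M_def)
qed

text \<open>Per move scanned 100 is charged, and 300 for the remaining work on a dequeued
  code.\<close>

definition dequeue_cost :: "nat \<Rightarrow> nat" where
  "dequeue_cost s = 300 + 100 * length (moves s)"

text \<open>Among the codes with a fixed \<open>t\<close>, the moving piece stands on each vertex in
  \<open>n ^ k\<close> of them. The 400 is 300 plus the 100 for staying put.\<close>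

lemma sum_dequeue_cost:
  "(\<Sum>s<total. dequeue_cost s) = (k + 1) * (n ^ k * (\<Sum>v = 1..n. 400 + 100 * degree E v))"
proof -
  have "(\<Sum>s<total. dequeue_cost s) = (\<Sum>t<k + 1. sum dequeue_cost {t * block..<t * block + block})"
    unfolding total_def by (rule sum.nat_group[symmetric])
  also have "\<dots> = (\<Sum>t<k + 1. n ^ k * (\<Sum>v = 1..n. 400 + 100 * degree E v))"
  proof (rule sum.cong)
    fix t
    assume "t \<in> {..<k + 1}"
    then have t: "t \<le> k"
      by simp
    have "sum dequeue_cost {t * block..<t * block + block} = (\<Sum>m<block. dequeue_cost (m + t * block))"
      using sum.shift_bounds_nat_ivl[of dequeue_cost 0 "t * block" block]
      by (simp add: lessThan_atLeast0 add.commute)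
    also have "\<dots> = (\<Sum>m<block. 400 + 100 * length (A (m div n ^ t mod n + 1)))"
    proof (rule sum.cong)
      fix m
      assume "m \<in> {..<block}"
      then have "last_moved (m + t * block) = t" "(m + t * block) mod block = m"
        by (simp_all add: last_moved_def)
      then show "dequeue_cost (m + t * block) = 400 + 100 * length (A (m div n ^ t mod n + 1))"
        using pos_mod_block[OF t, of "m + t * block"]
        by (simp add: dequeue_cost_def moves_def length_nbs pos_def)
    qed simp
    also have "\<dots> = n ^ k * (\<Sum>d<n. 400 + 100 * length (A (d + 1)))"
      unfolding block_def by (rule sum_digit[OF t n_pos])
    also have "(\<Sum>d<n. 400 + 100 * length (A (d + 1))) = (\<Sum>v = 1..n. 400 + 100 * length (A v))"
      by (simp add: sum.atLeast1_atMost_eq)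
    also have "\<dots> = (\<Sum>v = 1..n. 400 + 100 * degree E v)"
      by (intro sum.cong refl) (use degree_eq in simp)
    finally show "sum dequeue_cost {t * block..<t * block + block} =
      n ^ k * (\<Sum>v = 1..n. 400 + 100 * degree E v)" .
  qed simp
  finally show ?thesis
    by simp
qed

subsection \<open>Verification of the program\<close>

text \<open>A predicate of the two arrays alone: assignments to anything else leave it literally
  unchanged, so simplification carries it through the program.\<close>

definition lists_stored :: "(nat \<Rightarrow> nat) \<Rightarrow> (nat \<Rightarrow> nat) \<Rightarrow> bool" where
  "lists_stored st ad \<longleftrightarrow> (\<forall>v\<in>{1..n + 1}. st v = (\<Sum>u = 1..<v. length (A u))) \<and>
     (\<forall>v\<in>{1..n}. \<forall>j<length (A v). ad (st v + j) = A v ! j)"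

definition powers_stored :: "(nat \<Rightarrow> nat) \<Rightarrow> nat \<Rightarrow> bool" where
  "powers_stored pw m \<longleftrightarrow> (\<forall>i\<le>m. pw i = n ^ i)"

definition ready :: "state \<Rightarrow> bool" where
  "ready s \<longleftrightarrow> var s ''n'' = n \<and> var s ''k'' = k \<and> var s ''size'' = block \<and>
     lists_stored (arr s ''start'') (arr s ''adj'') \<and> powers_stored (arr s ''pow'') (Suc k)"

lemma length_list: "lists_stored st ad \<Longrightarrow> v \<in> {1..n} \<Longrightarrow> st (Suc v) - st v = length (A v)"
  by (simp add: lists_stored_def)

lemma nth_nbs:
  "lists_stored st ad \<Longrightarrow> v \<in> {1..n} \<Longrightarrow> j < length (nbs v) \<Longrightarrow>
    (if j = 0 then v else ad (st v + j - 1)) = nbs v ! j"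
  by (cases j) (auto simp: lists_stored_def nbs_def)

lemma pow_stored:
  "powers_stored (arr s ''pow'') (Suc k) \<Longrightarrow> i \<le> Suc k \<Longrightarrow> arr s ''pow'' i = n ^ i"
  by (simp add: powers_stored_def)

lemma powers_stored_0: "pw 0 = Suc 0 \<Longrightarrow> powers_stored pw 0"
  by (simp add: powers_stored_def)

lemma powers_stored_Suc: "powers_stored pw i \<Longrightarrow> powers_stored (pw(Suc i := pw i * n)) (Suc i)"
  by (auto simp: powers_stored_def le_Suc_eq)

lemma total_eq: "block + k * block = total"
  by (simp add: total_def)

lemma input_stored:
  "input_state n k A s \<longleftrightarrow>
     var s ''n'' = n \<and> var s ''k'' = k \<and> lists_stored (arr s ''start'') (arr s ''adj'')"
  by (simp add: input_state_def lists_stored_def)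

lemma wp_compute_powers:
  assumes "input_state n k A s"
  shows "wp compute_powers (\<lambda>s' \<tau>'. ready s' \<and> \<tau>' \<le> \<tau> + 100 + 40 * k) s \<tau>"
  using assms
  unfolding compute_powers_def input_stored
  apply simp
  apply (rule wp_For[where h = "k + 1" and I = "\<lambda>i s \<tau>'. var s ''n'' = n \<and> var s ''k'' = k \<and>
     lists_stored (arr s ''start'') (arr s ''adj'') \<and> powers_stored (arr s ''pow'') i \<and>
     \<tau>' \<le> \<tau> + 10 + 20 * i"])
       apply (simp_all add: powers_stored_0)
   apply (auto simp: powers_stored_Suc)[1]
  apply (auto simp: ready_def block_def pow_stored)[1]
  done

section \<open>Initialization of marks and counters\<close>

definition unmarked_below :: "(nat \<Rightarrow> nat) \<Rightarrow> nat \<Rightarrow> bool" where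
  "unmarked_below cp m \<longleftrightarrow> (\<forall>s<m. cp s = 0)"

lemma unmarked_below_0: "unmarked_below cp 0"
  by (simp add: unmarked_below_def)

lemma unmarked_below_Suc: "unmarked_below cp m \<Longrightarrow> unmarked_below (cp(m := 0)) (Suc m)"
  by (simp add: unmarked_below_def less_Suc_eq)

definition counters_init :: "(nat \<Rightarrow> nat) \<Rightarrow> nat \<Rightarrow> bool" where
  "counters_init ct m \<longleftrightarrow> (\<forall>s\<in>{k * block..<m}. ct s = length (robber_moves s))"

lemma counters_init_start: "counters_init ct (k * block)"
  by (simp add: counters_init_def)

lemma counters_init_Suc:
  "counters_init ct m \<Longrightarrow> lists_stored st ad \<Longrightarrow>
     counters_init (ct(m := Suc (st (Suc (Suc (m mod n))) - st (Suc (m mod n))))) (Suc m)"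
  using length_list[of st ad "pos m 0", OF _ pos_range]
  by (auto simp: counters_init_def less_Suc_eq robber_moves_def length_nbs pos_def)

lemma wp_initialize_arrays:
  assumes "ready s"
  shows "wp initialize_arrays (\<lambda>s' \<tau>'. ready s' \<and> unmarked_below (arr s' ''copswin'') total \<and>
    counters_init (arr s' ''counter'') total \<and> var s' ''head'' = 0 \<and> var s' ''tail'' = 0 \<and>
    \<tau>' \<le> \<tau> + 100 + 20 * total + 60 * total) s \<tau>"
  using assms
  unfolding initialize_arrays_def wp_Seq
  apply -
  apply (rule wp_For[where h = total and I = "\<lambda>i s \<tau>'. ready s \<and>
    unmarked_below (arr s ''copswin'') i \<and> \<tau>' \<le> \<tau> + 20 + 20 * i"])
       apply (simp_all add: ready_def total_eq unmarked_below_0 unmarked_below_Suc)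
  \<comment> \<open>The clock is bounded through the index \<open>i\<close> and not through the
    number \<open>i - k * block\<close> of iterations, at the price of \<open>60 * total\<close> in
    place of \<open>60 * block\<close>.\<close>
  apply (rule wp_For[where h = total and I = "\<lambda>i s \<tau>'. ready s \<and>
     unmarked_below (arr s ''copswin'') total \<and> counters_init (arr s ''counter'') i \<and>
     \<tau>' \<le> \<tau> + 60 + 20 * total + 60 * i"])
       apply (simp_all add: ready_def total_eq counters_init_start)
   apply (simp add: total_def)
  apply (elim conjE)
  apply (erule (1) counters_init_Suc)
  done

lemma robber_moves_not_Nil [simp]: "robber_moves q \<noteq> []"
  by (simp add: robber_moves_def nbs_def)

text \<open>Nothing has been dequeued, so a counter is the number of all moves; it is positive since
  staying put is one of them.\<close>

lemma queue_inv_init: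
  assumes "marks_inv e qu cp" "captures_marked cp" "counters_init ct total"
  shows "queue_inv 0 e qu cp ct"
proof -
  have "ct q = card (set (robber_moves q)) \<and> ct q \<noteq> 0" if "q < total" "last_moved q = k" for q
  proof -
    have "k * block \<le> q"
      using that by (metis last_moved_def div_times_less_eq_dividend)
    then have "ct q = length (robber_moves q)"
      using assms(3) that by (simp add: counters_init_def)
    moreover have "distinct (robber_moves q)"
      unfolding robber_moves_def by (rule distinct_nbs[OF pos_range])
    ultimately show ?thesis
      by (simp add: distinct_card robber_moves_def length_nbs)
  qed
  then show ?thesis
    using assms unfolding queue_inv_def counters_inv_def preds_marked_def by auto
qed

lemma marks_inv_init: "unmarked_below cp total \<Longrightarrow> marks_inv 0 qu cp"
  by (auto simp: marks_inv_def unmarked_below_def)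

section \<open>Enqueuing the captures\<close>

definition captures_below :: "(nat \<Rightarrow> nat) \<Rightarrow> nat \<Rightarrow> bool" where
  "captures_below cp m \<longleftrightarrow> (\<forall>s<m. capt s \<longrightarrow> cp s \<noteq> 0)"

definition cops_checked :: "(nat \<Rightarrow> nat) \<Rightarrow> nat \<Rightarrow> nat \<Rightarrow> bool" where
  "cops_checked cp s m \<longleftrightarrow> (\<forall>i\<in>{1..<m}. pos s i = pos s 0 \<longrightarrow> cp s \<noteq> 0)"

lemma captures_below_0: "captures_below cp 0"
  by (simp add: captures_below_def)

lemma captures_below_total: "captures_below cp total \<Longrightarrow> captures_marked cp"
  by (simp add: captures_below_def captures_marked_def)

lemma captures_below_Suc:
  "captures_below cp m \<Longrightarrow> cops_checked cp m (Suc k) \<Longrightarrow> captures_below cp (Suc m)"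
  by (auto simp: captures_below_def cops_checked_def capt_def less_Suc_eq atLeastLessThanSuc_atLeastAtMost)

lemma captures_below_mark: "captures_below cp m \<Longrightarrow> captures_below (cp(s := Suc 0)) m"
  by (simp add: captures_below_def)

lemma cops_checked_1: "cops_checked cp s (Suc 0)"
  by (simp add: cops_checked_def)

lemma cops_checked_mark: "cops_checked (cp(s := Suc 0)) s m"
  by (simp add: cops_checked_def)

lemma cops_checked_Suc:
  "cops_checked cp s i \<Longrightarrow> \<not> (s div n ^ i mod n = s mod n \<and> cp s = 0) \<Longrightarrow>
    cops_checked cp s (Suc i)"
  by (auto simp: cops_checked_def less_Suc_eq pos_def)

lemma win_if_same_digit:
  "s div n ^ i mod n = s mod n \<Longrightarrow> Suc 0 \<le> i \<Longrightarrow> i < Suc k \<Longrightarrow> win s"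
  by (rule win_if_capt) (auto simp: capt_def pos_def)

lemma wp_check_cops:
  assumes "ready s" "var s ''head'' = 0" "counters_init (arr s ''counter'') total"
    and "marks_inv (var s ''tail'') (arr s ''queue'') (arr s ''copswin'')"
    and "captures_below (arr s ''copswin'') c" "var s ''s'' = c" "c < total"
  shows "wp (FOR ''i'' FROM N 1 BELOW V ''k'' \<oplus> N 1 DO
          WHEN (V ''s'' DIV ''pow''\<lblot>V ''i''\<rblot>) MOD V ''n'' \<doteq> V ''s'' MOD V ''n''
               AND ''copswin''\<lblot>V ''s''\<rblot> \<doteq> N 0 DO
            enqueue_and_mark ''s'')
    (\<lambda>s' \<tau>'. ready s' \<and> var s' ''head'' = 0 \<and> counters_init (arr s' ''counter'') total \<and>
      marks_inv (var s' ''tail'') (arr s' ''queue'') (arr s' ''copswin'') \<and>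
      captures_below (arr s' ''copswin'') (Suc c) \<and> var s' ''s'' = c \<and> \<tau>' \<le> \<tau> + 20 + 40 * k) s \<tau>"
  using assms
  apply -
  \<comment> \<open>The index starts at 1; the 40 on the left pays for \<open>i - 1\<close>
    iterations without a subtraction.\<close>
  apply (rule wp_For[where h = "k + 1" and I = "\<lambda>i s \<tau>'. ready s \<and> var s ''head'' = 0 \<and>
      counters_init (arr s ''counter'') total \<and> var s ''s'' = c \<and>
      marks_inv (var s ''tail'') (arr s ''queue'') (arr s ''copswin'') \<and>
      captures_below (arr s ''copswin'') c \<and> cops_checked (arr s ''copswin'') c i \<and>
      \<tau>' + 40 \<le> \<tau> + 10 + 40 * i"])
       apply (simp_all add: ready_def enqueue_and_mark_def pow_stored cops_checked_1
      captures_below_mark cops_checked_mark cops_checked_Suc captures_below_Suc)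
  apply (intro impI, elim conjE, rule marks_inv_enqueue)
     apply (assumption | erule (2) win_if_same_digit)+
  done

lemma wp_enqueue_captures:
  assumes "ready s" "var s ''tail'' = 0" "unmarked_below (arr s ''copswin'') total"
    and "var s ''head'' = 0" "counters_init (arr s ''counter'') total"
  shows "wp enqueue_captures (\<lambda>s' \<tau>'. ready s' \<and>
    queue_inv (var s' ''head'') (var s' ''tail'') (arr s' ''queue'') (arr s' ''copswin'') (arr s' ''counter'') \<and>
    var s' ''head'' = 0 \<and> \<tau>' \<le> \<tau> + 20 + total * (50 + 50 * k)) s \<tau>"
  using assms marks_inv_init[OF assms(3)]
  unfolding enqueue_captures_def
  apply -
  apply (rule wp_For[where h = total and I = "\<lambda>i s \<tau>'. ready s \<and> var s ''head'' = 0 \<and>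
      counters_init (arr s ''counter'') total \<and>
      marks_inv (var s ''tail'') (arr s ''queue'') (arr s ''copswin'') \<and>
      captures_below (arr s ''copswin'') i \<and> \<tau>' \<le> \<tau> + 10 + i * (50 + 50 * k)"])
       apply (simp_all add: ready_def captures_below_0 total_def captures_below_total queue_inv_init
      del: One_nat_def)
  apply (rule wp_mono[OF wp_check_cops])
         apply (simp_all add: ready_def total_def)
  apply (elim conjE, intro conjI)
           apply (assumption | linarith)+
  done

section \<open>The main loop\<close>

definition base_code :: "nat \<Rightarrow> nat" where
  "base_code s = ((last_moved s + k) mod (k + 1)) * block +
     (s mod block - (pos s (last_moved s) - 1) * n ^ last_moved s)"

lemma pred_eq: "pred s v = base_code s + (v - 1) * n ^ last_moved s"
  by (simp add: pred_def recode_def base_code_def)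

text \<open>This and the next two definitions repeat parts of \<open>process_queue\<close> verbatim,
  so that folding them cuts the program into separately verified pieces.\<close>

definition select_neighbour :: com where
  "select_neighbour =
     (IF V ''j'' \<doteq> N 0
              THEN ''v'' ::= V ''p''
              ELSE ''v'' ::= ''adj''\<lblot>''start''\<lblot>V ''p''\<rblot> \<oplus> V ''j'' \<ominus> N 1\<rblot>)"

definition visit_pred :: com where
  "visit_pred =
     (''q'' ::= V ''base'' \<oplus> (V ''v'' \<ominus> N 1) \<otimes> ''pow''\<lblot>V ''t''\<rblot> ;;
             (IF V ''t'' \<doteq> N 0
              THEN
                (''counter''\<lblot>V ''q''\<rblot> \<leftarrow> ''counter''\<lblot>V ''q''\<rblot> \<ominus> N 1 ;;
                 (WHEN ''counter''\<lblot>V ''q''\<rblot> \<doteq> N 0 AND ''copswin''\<lblot>V ''q''\<rblot> \<doteq> N 0 DO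
                    enqueue_and_mark ''q''))
              ELSE
                (WHEN ''copswin''\<lblot>V ''q''\<rblot> \<doteq> N 0 DO
                   enqueue_and_mark ''q'')))"

definition scan_preds :: com where
  "scan_preds =
     (FOR ''j'' FROM N 0 BELOW N 1 \<oplus> (''start''\<lblot>V ''p'' \<oplus> N 1\<rblot> \<ominus> ''start''\<lblot>V ''p''\<rblot>) DO
        (select_neighbour ;; visit_pred))"

lemmas process_queue_eq =
  process_queue_def[folded select_neighbour_def, folded visit_pred_def, folded scan_preds_def]

text \<open>The program has already advanced \<open>head\<close>, while \<open>h\<close> is still
  the cell of \<open>s\<close>.\<close>

definition scanning where
  "scanning h D s j \<sigma> \<longleftrightarrow> ready \<sigma> \<and> var \<sigma> ''t'' = last_moved s \<and>
     var \<sigma> ''p'' = pos s (last_moved s) \<and> var \<sigma> ''base'' = base_code s \<and> var \<sigma> ''head'' = Suc h \<and>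
     scan_inv h D s j (var \<sigma> ''tail'') (arr \<sigma> ''queue'') (arr \<sigma> ''copswin'') (arr \<sigma> ''counter'')"

lemma wp_select_neighbour:
  assumes "scanning h D s j \<sigma>" "var \<sigma> ''j'' = j" "j < length (moves s)"
  shows "wp select_neighbour
     (\<lambda>\<sigma>' \<tau>'. \<sigma>' = \<sigma>\<lparr>var := (var \<sigma>)(''v'' := moves s ! j)\<rparr> \<and> \<tau>' \<le> \<tau> + 20) \<sigma> \<tau>"
  unfolding select_neighbour_def
  using assms nth_nbs[of "arr \<sigma> ''start''" "arr \<sigma> ''adj''" "pos s (last_moved s)" j, OF _ pos_range]
  by (auto simp: scanning_def ready_def moves_def)

lemma wp_visit:
  assumes "scanning h D s j \<sigma>" "var \<sigma> ''j'' = j" "j < length (moves s)" "var \<sigma> ''v'' = moves s ! j"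
  shows "wp visit_pred
     (\<lambda>\<sigma>' \<tau>'. var \<sigma>' ''j'' = j \<and> scanning h D s (Suc j) \<sigma>' \<and> \<tau>' \<le> \<tau> + 60) \<sigma> \<tau>"
proof -
  define q where "q = pred s (moves s ! j)"
  have inv: "scan_inv h D s j (var \<sigma> ''tail'') (arr \<sigma> ''queue'') (arr \<sigma> ''copswin'') (arr \<sigma> ''counter'')"
    and r: "ready \<sigma>" "var \<sigma> ''t'' = last_moved s" "var \<sigma> ''p'' = pos s (last_moved s)"
      "var \<sigma> ''base'' = base_code s" "var \<sigma> ''head'' = Suc h"
    using assms(1) by (auto simp: scanning_def)
  have "last_moved s \<le> k"
    using last_moved_le scan_facts(1)[OF inv] by blast
  then have "arr \<sigma> ''pow'' (last_moved s) = n ^ last_moved s"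
    using r(1) by (simp add: ready_def pow_stored)
  then have q: "base_code s + (moves s ! j - Suc 0) * arr \<sigma> ''pow'' (last_moved s) = q"
    by (simp add: q_def pred_eq)
  show ?thesis
  proof (cases "last_moved s = 0")
    case True
    note robber = scan_robber[OF inv True assms(3) q_def]
    show ?thesis
      using robber r q assms(2,4) True
      by (simp add: visit_pred_def scanning_def enqueue_and_mark_def ready_def)
  next
    case False
    note cop = scan_cop_marked[OF inv False assms(3), folded q_def]
      scan_cop_unmarked[OF inv False assms(3) q_def]
    show ?thesis
      using cop r q assms(2,4) False
      by (simp add: visit_pred_def scanning_def enqueue_and_mark_def ready_def)
  qed
qed

lemma wp_scan:
  assumes "scanning h D s 0 \<sigma>"
  shows "wp scan_preds (\<lambda>\<sigma>' \<tau>'. scanning h D s (length (moves s)) \<sigma>' \<and>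
    \<tau>' \<le> \<tau> + 100 + 100 * length (moves s)) \<sigma> \<tau>"
  unfolding scan_preds_def
\<comment> \<open>An iteration costs at most 20 for the selection, 60 for the visit, 12 for the test
  and 4 for the increment.\<close>
proof (rule wp_For[where h = "length (moves s)" and
      I = "\<lambda>j \<sigma> \<tau>'. scanning h D s j \<sigma> \<and> \<tau>' \<le> \<tau> + 10 + 100 * j"], goal_cases)
  case (3 j \<sigma> \<tau>')
  then have "lists_stored (arr \<sigma> ''start'') (arr \<sigma> ''adj'')" "var \<sigma> ''p'' = pos s (last_moved s)"
    by (auto simp: scanning_def ready_def)
  then show ?case
    using length_list[OF _ pos_range] by (simp add: moves_def length_nbs)
next
  case (4 j \<sigma> \<tau>')
  show ?case
    unfolding wp_Seq
  proof (rule wp_mono[OF wp_select_neighbour[of h D s j]], goal_cases)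
    case (4 \<sigma>1 \<tau>1)
    have "scanning h D s j \<sigma>1" "var \<sigma>1 ''j'' = j" "var \<sigma>1 ''v'' = moves s ! j"
      using 4 \<open>scanning h D s j \<sigma> \<and> _\<close> \<open>var \<sigma> ''j'' = j\<close> by (simp_all add: scanning_def ready_def)
    from wp_visit[OF this(1,2) \<open>j < length (moves s)\<close> this(3)] show ?case
      by (rule wp_mono) (use 4 \<open>scanning h D s j \<sigma> \<and> _\<close> in \<open>simp add: scanning_def ready_def\<close>)
  qed (use 4 in auto)
qed (use assms in \<open>simp_all add: scanning_def ready_def\<close>)

definition decides :: "(nat \<Rightarrow> nat) \<Rightarrow> bool" where
  "decides cp \<longleftrightarrow> (\<forall>s<total. cp s \<noteq> 0 \<longleftrightarrow> win s)"

text \<open>The clock is charged to the set of dequeued codes. The next code is not yet in that set,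
  so its cost is added once; at the end the set is contained in \<open>{..<total}\<close>.\<close>

lemma wp_process_queue:
  assumes "ready \<sigma>" "var \<sigma> ''head'' = 0"
    and "queue_inv (var \<sigma> ''head'') (var \<sigma> ''tail'') (arr \<sigma> ''queue'') (arr \<sigma> ''copswin'') (arr \<sigma> ''counter'')"
  shows "wp process_queue (\<lambda>\<sigma>' \<tau>'. ready \<sigma>' \<and> decides (arr \<sigma>' ''copswin'') \<and>
    \<tau>' \<le> \<tau> + 10 + (\<Sum>s<total. dequeue_cost s)) \<sigma> \<tau>"
  unfolding process_queue_eq
proof (rule wp_While[where m = "\<lambda>\<sigma>. total - var \<sigma> ''head''" and I = "\<lambda>\<sigma> \<tau>'. ready \<sigma> \<and>
    queue_inv (var \<sigma> ''head'') (var \<sigma> ''tail'') (arr \<sigma> ''queue'') (arr \<sigma> ''copswin'') (arr \<sigma> ''counter'') \<and>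
    \<tau>' \<le> \<tau> + sum dequeue_cost (arr \<sigma> ''queue'' ` {..<var \<sigma> ''head''})"], goal_cases)
  case 1
  then show ?case
    using assms by simp
next
  case (2 \<sigma> \<tau>')
  define h where "h = var \<sigma> ''head''"
  define D where "D = arr \<sigma> ''queue'' ` {..<h}"
  define s where "s = arr \<sigma> ''queue'' h"
  have lt: "h < var \<sigma> ''tail''"
    using 2 by (simp add: h_def)
  then have scan: "scan_inv h D s 0 (var \<sigma> ''tail'') (arr \<sigma> ''queue'') (arr \<sigma> ''copswin'') (arr \<sigma> ''counter'')"
    using 2 scan_start by (simp add: h_def D_def s_def)
  note f = scan_facts[OF scan]
  have pow: "arr \<sigma> ''pow'' (s div block) = n ^ (s div block)"
    using 2 last_moved_le[OF f(1)] by (simp add: ready_def pow_stored last_moved_def)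
  have "h < total"
    using lt scan marks_inv_le_total unfolding scan_inv_def by fastforce
  have step: "(ready \<sigma>' \<and> queue_inv (var \<sigma>' ''head'') (var \<sigma>' ''tail'') (arr \<sigma>' ''queue'')
        (arr \<sigma>' ''copswin'') (arr \<sigma>' ''counter'') \<and>
      \<tau>'' \<le> \<tau> + sum dequeue_cost (arr \<sigma>' ''queue'' ` {..<var \<sigma>' ''head''})) \<and>
      total - var \<sigma>' ''head'' < total - h"
    if "scanning h D s (length (moves s)) \<sigma>'" "\<tau>'' \<le> \<tau>' + 100 + 200 + 100 * length (moves s)" for \<sigma>' \<tau>''
  proof -
    have \<sigma>': "ready \<sigma>'" "var \<sigma>' ''head'' = Suc h" "scan_inv h D s (length (moves s)) (var \<sigma>' ''tail'')
        (arr \<sigma>' ''queue'') (arr \<sigma>' ''copswin'') (arr \<sigma>' ''counter'')"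
      using that(1) by (auto simp: scanning_def)
    note e = scan_end[OF \<sigma>'(3)]
    have "sum dequeue_cost (insert s D) = dequeue_cost s + sum dequeue_cost D"
      using f by simp
    then have "\<tau>'' \<le> \<tau> + sum dequeue_cost (insert s D)"
      using 2 that(2) by (simp add: D_def h_def dequeue_cost_def)
    then show ?thesis
      using \<sigma>' e \<open>h < total\<close> by auto
  qed
  show ?case
    unfolding wp_Seq wp_Assign
  proof (rule wp_mono[OF wp_scan[where h = h and D = D and s = s]], goal_cases)
    case 1
    then show ?case
      using scan pow 2 by (simp add: scanning_def ready_def base_code_def pos_def last_moved_def s_def h_def)
  next
    case (2 \<sigma>' \<tau>'')
    then show ?case
      using step[of \<sigma>' \<tau>''] by (simp add: h_def)
  qed
next
  case (3 \<sigma> \<tau>')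
  then have inv: "queue_inv (var \<sigma> ''head'') (var \<sigma> ''tail'') (arr \<sigma> ''queue'') (arr \<sigma> ''copswin'') (arr \<sigma> ''counter'')"
    and le: "var \<sigma> ''tail'' \<le> var \<sigma> ''head''"
    by simp_all
  have "arr \<sigma> ''queue'' ` {..<var \<sigma> ''head''} \<subseteq> {..<total}"
    using inv marks_inv_less unfolding queue_inv_def by (fastforce dest: less_le_trans)
  then have "sum dequeue_cost (arr \<sigma> ''queue'' ` {..<var \<sigma> ''head''}) \<le> (\<Sum>s<total. dequeue_cost s)"
    by (intro sum_mono2) auto
  then show ?case
    using 3 queue_inv_finished[OF inv le] by (simp add: decides_def)
qed

section \<open>Reading off the answer\<close>

definition wins_below :: "nat \<Rightarrow> nat \<Rightarrow> bool" where
  "wins_below c m \<longleftrightarrow> (\<forall>p\<in>{1..<m}. win ((p - 1) + n * c))"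

definition winning_placement_below :: "nat \<Rightarrow> bool" where
  "winning_placement_below m \<longleftrightarrow> (\<exists>c<m. wins_below c (Suc n))"

lemma wins_below_1: "wins_below c (Suc 0)"
  by (simp add: wins_below_def)

lemma wins_below_Suc:
  "Suc 0 \<le> p \<Longrightarrow> wins_below c (Suc p) \<longleftrightarrow> wins_below c p \<and> win (p + n * c - Suc 0)"
  by (auto simp: wins_below_def less_Suc_eq)

lemma winning_placement_below_0: "\<not> winning_placement_below 0"
  by (simp add: winning_placement_below_def)

lemma winning_placement_below_Suc:
  "winning_placement_below (Suc c) \<longleftrightarrow> winning_placement_below c \<or> wins_below c (Suc n)"
  by (auto simp: winning_placement_below_def less_Suc_eq)

lemma winning_placement_below_iff: "winning_placement_below (n ^ k) \<longleftrightarrow> copwin n E k"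
  by (simp add: winning_placement_below_def wins_below_def copwin_iff_code
      atLeastLessThanSuc_atLeastAtMost)

text \<open>The index is \<open>(p - 1) + n * c\<close> with the subtraction moved outwards. It is
  below \<open>n * Suc c\<close>, hence below \<open>n ^ (k + 1)\<close>.\<close>

lemma decidesD:
  assumes "decides (arr \<sigma> ''copswin'')" "c < n ^ k" "Suc 0 \<le> p" "p < Suc n"
  shows "arr \<sigma> ''copswin'' (p + n * c - Suc 0) = 0 \<longleftrightarrow> \<not> win (p + n * c - Suc 0)"
proof -
  have "p + n * c - Suc 0 < n * Suc c"
    using assms(3,4) by auto
  also have "\<dots> \<le> n * n ^ k"
    using assms(2) by (intro mult_le_mono2) simp
  also have "\<dots> \<le> total"
    by (simp add: total_def block_def)
  finally show ?thesis
    using assms(1) unfolding decides_def by blast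
qed

lemma of_bool_eq_Suc_0: "of_bool P = Suc 0 \<longleftrightarrow> P"
  by (cases P) simp_all

lemma wp_compute_output:
  assumes "ready s" "decides (arr s ''copswin'')"
  shows "wp compute_output (\<lambda>s' \<tau>'. var s' ''result'' = of_bool (copwin n E k) \<and>
    \<tau>' \<le> \<tau> + 20 + n ^ k * (100 + 50 * n)) s \<tau>"
  using assms
  unfolding compute_output_def wp_Seq wp_Assign
  apply -
  apply (rule wp_For[where h = "n ^ k" and I = "\<lambda>c s \<tau>'. ready s \<and> decides (arr s ''copswin'') \<and>
     var s ''result'' = of_bool (winning_placement_below c) \<and>
     \<tau>' \<le> \<tau> + 10 + c * (100 + 50 * n)"])
       apply (simp_all add: ready_def winning_placement_below_0
      winning_placement_below_iff pow_stored split del: split_of_bool)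
  subgoal for c s1 \<tau>1
    apply (rule wp_For[where h = "Suc n" and I = "\<lambda>p s \<tau>'. ready s \<and> decides (arr s ''copswin'') \<and>
     var s ''c'' = c \<and> var s ''result'' = of_bool (winning_placement_below c) \<and>
     var s ''all'' = of_bool (wins_below c p) \<and>
     \<tau>' \<le> \<tau> + 20 + c * (100 + 50 * n) + 30 * p"])
         apply (simp_all add: ready_def wins_below_1 wins_below_Suc decidesD of_bool_eq_Suc_0
        winning_placement_below_Suc)
    done
  done

section \<open>The whole program and its running time\<close>

lemma wp_copwin_algorithm:
  assumes "input_state n k A s"
  shows "wp copwin_algorithm (\<lambda>s' \<tau>. var s' ''result'' = of_bool (copwin n E k) \<and>
    \<tau> \<le> 300 + 40 * k + (130 + 50 * k) * total + (\<Sum>s<total. dequeue_cost s) + n ^ k * (100 + 50 * n)) s 0"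
proof (cases "k < n")
  case False
  then show ?thesis
    using assms copwin_if_many_cops by (simp add: copwin_algorithm_def input_state_def)
next
  case True
  have *: "bval (bexp.Not (V ''k'' \<prec> V ''n'')) s \<longleftrightarrow> False"
    using True assms by (simp add: input_state_def)
  show ?thesis
    unfolding copwin_algorithm_def wp_If * if_False wp_Seq
  proof (rule wp_mono[OF wp_compute_powers[OF assms]], elim conjE)
    fix s1 \<tau>1
    assume s1: "ready s1" "\<tau>1 \<le> 0 + (bcost (bexp.Not (V ''k'' \<prec> V ''n'')) + 1) + 100 + 40 * k"
    show "wp initialize_arrays (wp enqueue_captures (wp process_queue (wp compute_output
      (\<lambda>s' \<tau>. var s' ''result'' = of_bool (copwin n E k) \<and>
    \<tau> \<le> 300 + 40 * k + (130 + 50 * k) * total + (\<Sum>s<total. dequeue_cost s) + n ^ k * (100 + 50 * n))))) s1 \<tau>1"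
    proof (rule wp_mono[OF wp_initialize_arrays[OF s1(1)]], elim conjE)
      fix s2 \<tau>2
      assume s2: "ready s2" "unmarked_below (arr s2 ''copswin'') total"
        "counters_init (arr s2 ''counter'') total" "var s2 ''head'' = 0" "var s2 ''tail'' = 0"
        "\<tau>2 \<le> \<tau>1 + 100 + 20 * total + 60 * total"
      show "wp enqueue_captures (wp process_queue (wp compute_output
      (\<lambda>s' \<tau>. var s' ''result'' = of_bool (copwin n E k) \<and>
    \<tau> \<le> 300 + 40 * k + (130 + 50 * k) * total + (\<Sum>s<total. dequeue_cost s) + n ^ k * (100 + 50 * n)))) s2 \<tau>2"
      proof (rule wp_mono[OF wp_enqueue_captures[OF s2(1,5,2,4,3)]], elim conjE)
        fix s3 \<tau>3
        assume s3: "ready s3" "queue_inv (var s3 ''head'') (var s3 ''tail'') (arr s3 ''queue'')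
            (arr s3 ''copswin'') (arr s3 ''counter'')" "var s3 ''head'' = 0"
          "\<tau>3 \<le> \<tau>2 + 20 + total * (50 + 50 * k)"
        show "wp process_queue (wp compute_output
      (\<lambda>s' \<tau>. var s' ''result'' = of_bool (copwin n E k) \<and>
    \<tau> \<le> 300 + 40 * k + (130 + 50 * k) * total + (\<Sum>s<total. dequeue_cost s) + n ^ k * (100 + 50 * n))) s3 \<tau>3"
        proof (rule wp_mono[OF wp_process_queue[OF s3(1,3,2)]], elim conjE)
          fix s4 \<tau>4
          assume s4: "ready s4" "decides (arr s4 ''copswin'')"
            "\<tau>4 \<le> \<tau>3 + 10 + (\<Sum>s<total. dequeue_cost s)"
          show "wp compute_output
      (\<lambda>s' \<tau>. var s' ''result'' = of_bool (copwin n E k) \<and>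
    \<tau> \<le> 300 + 40 * k + (130 + 50 * k) * total + (\<Sum>s<total. dequeue_cost s) + n ^ k * (100 + 50 * n)) s4 \<tau>4"
            by (rule wp_mono[OF wp_compute_output[OF s4(1,2)]])
              (use s1(2) s2(6) s3(4) s4(3) in \<open>simp add: algebra_simps\<close>)
        qed
      qed
    qed
  qed
qed

lemma cost_bound:
  assumes "1 \<le> k"
    and "t \<le> 300 + 40 * k + (130 + 50 * k) * total + (\<Sum>s<total. dequeue_cost s) + n ^ k * (100 + 50 * n)"
  shows "real t \<le> 2000 * (real k * real n ^ (k + 1) * (average_degree n E + real k))"
proof -
  define b where "b = real n ^ (k + 1)"
  define a where "a = average_degree n E"
  define x where "x = real k"
  have x: "1 \<le> x"
    using assms(1) by (simp add: x_def)
  have n: "1 \<le> real n"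
    using n_pos by simp
  have pow: "real n ^ k \<le> b" "1 \<le> b"
    using n by (simp_all add: b_def power_increasing one_le_power del: power_Suc)
  have a: "0 \<le> a"
    by (simp add: a_def average_degree_def sum_nonneg)
  have "real (\<Sum>v = 1..n. 400 + 100 * degree E v) = 400 * real n + 100 * (\<Sum>v = 1..n. real (degree E v))"
    by (simp add: sum.distrib sum_distrib_left)
  also have "(\<Sum>v = 1..n. real (degree E v)) = real n * a"
    using n by (simp add: a_def average_degree_def)
  finally have deg: "real (\<Sum>v = 1..n. 400 + 100 * degree E v) = real n * (400 + 100 * a)"
    by (simp add: algebra_simps)
  have "real (\<Sum>s<total. dequeue_cost s) = (x + 1) * (real n ^ k * (real n * (400 + 100 * a)))"
    unfolding sum_dequeue_cost of_nat_mult deg by (simp add: x_def)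
  then have queue: "real (\<Sum>s<total. dequeue_cost s) = (x + 1) * (b * (400 + 100 * a))"
    by (simp add: b_def mult.assoc mult.left_commute)
  have "real t \<le> real (300 + 40 * k + (130 + 50 * k) * total + (\<Sum>s<total. dequeue_cost s) +
      n ^ k * (100 + 50 * n))"
    using assms(2) of_nat_le_iff by blast
  also have "\<dots> = 300 + 40 * x + (130 + 50 * x) * ((x + 1) * b) + (x + 1) * (b * (400 + 100 * a)) +
      100 * real n ^ k + 50 * b"
    unfolding of_nat_add queue by (simp add: total_def block_def x_def b_def algebra_simps)
  \<comment> \<open>As \<open>x\<close> and \<open>b\<close> are at least 1, every term without
    \<open>a\<close> is at most its coefficient times \<open>x * (x * b)\<close>. In the expanded
    form below these coefficients add up to 1650 and the others to 200, so 2000 suffices.\<close>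
  also have "\<dots> \<le> 2000 * (x * b * (a + x))"
  proof -
    have grow: "z \<le> x * z" if "0 \<le> z" for z
      using mult_right_mono[OF x that] by simp
    have "0 \<le> b" "0 \<le> a * b" "0 \<le> x * b"
      using pow a x by simp_all
    note grow[OF this(1)] grow[OF this(2)] grow[OF this(3)]
    moreover from this(1) have "x * 1 \<le> x * (x * b)"
      using pow x by (intro mult_left_mono) linarith+
    moreover have "0 \<le> x * (a * b)"
      using x pow a by simp
    moreover have "300 + 40 * x + (130 + 50 * x) * ((x + 1) * b) + (x + 1) * (b * (400 + 100 * a)) +
        100 * real n ^ k + 50 * b =
      300 + 40 * x + 580 * b + 580 * (x * b) + 50 * (x * (x * b)) + 100 * (a * b) +
        100 * (x * (a * b)) + 100 * real n ^ k"
      by (simp add: algebra_simps)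
    moreover have "2000 * (x * b * (a + x)) = 2000 * (x * (a * b)) + 2000 * (x * (x * b))"
      by (simp add: algebra_simps)
    ultimately show ?thesis
      using x pow by linarith
  qed
  finally show ?thesis
    by (simp add: a_def b_def x_def)
qed

end

theorem theorem3:
  shows "\<exists>C::real. \<forall>(n::nat) (k::nat) (E::nat set set) (A::nat \<Rightarrow> nat list) (s::state).
    1 \<le> n \<longrightarrow> simple_graph n E \<longrightarrow> adjacency_lists n E A \<longrightarrow> input_state n k A s \<longrightarrow>
    (\<exists>t s'. \<langle>copwin_algorithm, s\<rangle> \<Rightarrow> t \<Down> s' \<and>
       var s' ''result'' = (if copwin n E k then 1 else 0) \<and>
       (1 \<le> k \<longrightarrow>
          real t \<le> C * (real k * real n ^ (k + 1) * (average_degree n E + real k))))"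
proof (rule exI[of _ 2000], intro allI impI)
  fix n k E A s
  assume asm: "1 \<le> n" "simple_graph n E" "adjacency_lists n E A" "input_state n k A s"
  then interpret algorithm n k E A
    by unfold_locales simp_all
  obtain t s' where "\<langle>copwin_algorithm, s\<rangle> \<Rightarrow> t \<Down> s'" "var s' ''result'' = of_bool (copwin n E k)"
    "t \<le> 300 + 40 * k + (130 + 50 * k) * total + (\<Sum>s<total. dequeue_cost s) + n ^ k * (100 + 50 * n)"
    using wp_copwin_algorithm[OF asm(4)] by (auto simp: wp_def)
  then show "\<exists>t s'. \<langle>copwin_algorithm, s\<rangle> \<Rightarrow> t \<Down> s' \<and>
       var s' ''result'' = (if copwin n E k then 1 else 0) \<and>
       (1 \<le> k \<longrightarrow>
          real t \<le> 2000 * (real k * real n ^ (k + 1) * (average_degree n E + real k)))"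
    using cost_bound by (intro exI[of _ t] exI[of _ s']) (simp add: of_bool_def)
qed

end
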